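(* Let $\mathbb{K}$ be a field of characteristic $0$, let $n\ge 3$ be an integer, let $V=\mathbb{K}^n$ with standard basis $e_1,\dots,e_n$, and let $$\det\nolimits_n=\sum_{\sigma\in\mathfrak{S}_n}\operatorname{sgn}(\sigma)\,e_{\sigma(1)}\otimes\cdots\otimes e_{\sigma(n)},\qquad \operatorname{perm}_n=\sum_{\sigma\in\mathfrak{S}_n}e_{\sigma(1)}\otimes\cdots\otimes e_{\sigma(n)}$$ be the determinant and permanent tensors in $V^{\otimes n}$. Then $$\mathbf{R}(\operatorname{perm}_n)\ \le\ 2^{n-1}\ <\ \frac{n^{n-1}}{(n-1)!}\ \le\ \underline{\mathbf{R}}(\det\nolimits_n)\ \le\ \mathbf{R}(\det\nolimits_n).$$
   Context: $\mathfrak{S}_n$ is the symmetric group on $n$ letters. For finite-dimensional $\mathbb{K}$-vector spaces $V_1,\dots,V_d$ and $T\in V_1\otimes\cdots\otimes V_d$, the tensor rank $\mathbf{R}(T)$ is the minimal $k$ such that $T=\sum_{i=1}^k v_{i,1}\otimes\cdots\otimes v_{i,d}$ with $v_{i,j}\in V_j$. The border rank $\underline{\mathbf{R}}(T)$ is the minimal $k$ such that $T$ lies in the Zariski closure, in $V_1\otimes\cdots\otimes V_d$, of the set of tensors of tensor rank $\le k$. *)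

theory Defs
  imports
    "Jordan_Normal_Form.Matrix"
    "HOL-Combinatorics.Permutations"
begin

text \<open>
  A tensor in \<open>K^m\<^sub>1 \<otimes> \<dots> \<otimes> K^m\<^sub>d\<close> is represented by its coordinates with respect to the basis
  \<open>e\<^sub>i\<^sub>1 \<otimes> \<dots> \<otimes> e\<^sub>i\<^sub>d\<close>, i.e. by a function on multi-indices of length \<open>d\<close>, extended by \<open>0\<close>.
  The list \<open>ms = [m\<^sub>1, \<dots>, m\<^sub>d]\<close> is the format; indices start at \<open>0\<close>.
\<close>

type_synonym 'a tensor = "nat list \<Rightarrow> 'a"

definition multi_indices :: "nat list \<Rightarrow> nat list set" where
  "multi_indices ms = {I. list_all2 (<) I ms}"

definition tensor_space :: "nat list \<Rightarrow> 'a::zero tensor set" where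
  "tensor_space ms = {T. \<forall>I. I \<notin> multi_indices ms \<longrightarrow> T I = 0}"

definition pure_tensor :: "'a::comm_ring_1 vec list \<Rightarrow> 'a tensor" where
  "pure_tensor vs = (\<lambda>I.
     if I \<in> multi_indices (map dim_vec vs) then \<Prod>j<length vs. (vs ! j) $ (I ! j) else 0)"

definition is_sum_of_pure_tensors :: "nat list \<Rightarrow> nat \<Rightarrow> 'a::comm_ring_1 tensor \<Rightarrow> bool" where
  "is_sum_of_pure_tensors ms k T \<longleftrightarrow>
     (\<exists>v :: nat \<Rightarrow> 'a vec list.
        (\<forall>i<k. map dim_vec (v i) = ms) \<and> T = (\<lambda>I. \<Sum>i<k. pure_tensor (v i) I))"

definition tensor_rank :: "nat list \<Rightarrow> 'a::field tensor \<Rightarrow> nat" where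
  "tensor_rank ms T = (LEAST k. is_sum_of_pure_tensors ms k T)"

inductive_set polynomial_functions :: "nat list \<Rightarrow> ('a::comm_ring_1 tensor \<Rightarrow> 'a) set"
  for ms :: "nat list" where
  const: "(\<lambda>_. c) \<in> polynomial_functions ms"
| coord: "I \<in> multi_indices ms \<Longrightarrow> (\<lambda>T. T I) \<in> polynomial_functions ms"
| add: "p \<in> polynomial_functions ms \<Longrightarrow> q \<in> polynomial_functions ms \<Longrightarrow>
    (\<lambda>T. p T + q T) \<in> polynomial_functions ms"
| mult: "p \<in> polynomial_functions ms \<Longrightarrow> q \<in> polynomial_functions ms \<Longrightarrow>
    (\<lambda>T. p T * q T) \<in> polynomial_functions ms"

definition zariski_closed :: "nat list \<Rightarrow> 'a::field tensor set \<Rightarrow> bool" where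
  "zariski_closed ms Z \<longleftrightarrow>
     (\<exists>P \<subseteq> polynomial_functions ms. Z = {T \<in> tensor_space ms. \<forall>p\<in>P. p T = 0})"

definition zariski_closure :: "nat list \<Rightarrow> 'a::field tensor set \<Rightarrow> 'a tensor set" where
  "zariski_closure ms A = \<Inter>{Z. zariski_closed ms Z \<and> A \<subseteq> Z}"

definition border_rank :: "nat list \<Rightarrow> 'a::field tensor \<Rightarrow> nat" where
  "border_rank ms T =
     (LEAST k. T \<in> zariski_closure ms {S \<in> tensor_space ms. tensor_rank ms S \<le> k})"

definition det_tensor :: "nat \<Rightarrow> 'a::field tensor" where
  "det_tensor n = (\<lambda>I. \<Sum>\<sigma> | \<sigma> permutes {..<n}.
     of_int (sign \<sigma>) * pure_tensor (map (\<lambda>j. unit_vec n (\<sigma> j)) [0..<n]) I)"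

definition perm_tensor :: "nat \<Rightarrow> 'a::field tensor" where
  "perm_tensor n = (\<lambda>I. \<Sum>\<sigma> | \<sigma> permutes {..<n}.
     pure_tensor (map (\<lambda>j. unit_vec n (\<sigma> j)) [0..<n]) I)"

text \<open>
  Both \<open>LEAST\<close> operators above range over nonempty sets: every tensor of order at least one has a
  decomposition into pure tensors. (For \<open>ms = []\<close> the only pure tensor is the scalar \<open>1\<close>, and
  \<^const>\<open>tensor_rank\<close> is meaningless.)
\<close>

lemma finite_multi_indices: "finite (multi_indices ms)"
proof -
  have "multi_indices ms \<subseteq> {I. set I \<subseteq> {..<Suc (sum_list ms)} \<and> length I = length ms}"
  proof
    fix I assume "I \<in> multi_indices ms"
    then have *: "length I = length ms" "\<And>j. j < length ms \<Longrightarrow> I ! j < ms ! j"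
      by (auto simp: multi_indices_def list_all2_conv_all_nth)
    have "I ! j < Suc (sum_list ms)" if "j < length ms" for j
      using *(2)[OF that] member_le_sum_list[of "ms ! j" ms] that by force
    then show "I \<in> {I. set I \<subseteq> {..<Suc (sum_list ms)} \<and> length I = length ms}"
      using *(1) by (auto simp: in_set_conv_nth)
  qed
  then show ?thesis
    by (rule finite_subset) (simp add: finite_lists_length_eq)
qed

lemma is_sum_of_pure_tensors_ex:
  fixes T :: "'a::field tensor"
  assumes "ms \<noteq> []" and T: "T \<in> tensor_space ms"
  shows "\<exists>k. is_sum_of_pure_tensors ms k T"
proof -
  define w :: "nat list \<Rightarrow> 'a vec list" where
    "w J = map (\<lambda>j. (if j = 0 then T J else 1) \<cdot>\<^sub>v unit_vec (ms ! j) (J ! j)) [0..<length ms]" for J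
  have dim: "map dim_vec (w J) = ms" for J
    by (rule nth_equalityI) (auto simp: w_def)
  have len: "length (w J) = length ms" for J by (simp add: w_def)
  have w: "pure_tensor (w J) I = (if J = I then T I else 0)"
    if J: "J \<in> multi_indices ms" for I J
  proof (cases "I \<in> multi_indices ms")
    case True
    have IJ: "length I = length ms" "length J = length ms"
      "\<And>j. j < length ms \<Longrightarrow> I ! j < ms ! j" "\<And>j. j < length ms \<Longrightarrow> J ! j < ms ! j"
      using True J by (auto simp: multi_indices_def list_all2_conv_all_nth)
    have "pure_tensor (w J) I = (\<Prod>j<length ms. (w J ! j) $ (I ! j))"
      using True by (simp add: pure_tensor_def dim len)
    also have "\<dots> = (\<Prod>j<length ms. (if j = 0 then T J else 1) * (if I ! j = J ! j then 1 else 0))"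
      by (rule prod.cong) (use IJ in \<open>auto simp: w_def\<close>)
    also have "\<dots> = (if J = I then T I else 0)"
    proof (cases "J = I")
      case True
      then show ?thesis using assms(1) by (simp add: prod.delta)
    next
      case False
      then obtain j where "j < length ms" "I ! j \<noteq> J ! j"
        using IJ by (metis nth_equalityI)
      then show ?thesis using False by (auto intro!: bexI[of _ j])
    qed
    finally show ?thesis .
  next
    case False
    then show ?thesis using J by (auto simp: pure_tensor_def dim)
  qed
  obtain h where h: "bij_betw h {..<card (multi_indices ms)} (multi_indices ms)"
    using ex_bij_betw_nat_finite[OF finite_multi_indices, of ms] by (auto simp: atLeast0LessThan)
  have "T = (\<lambda>I. \<Sum>i<card (multi_indices ms). pure_tensor (w (h i)) I)"
  proof
    fix I
    have "(\<Sum>i<card (multi_indices ms). pure_tensor (w (h i)) I)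
        = (\<Sum>J\<in>multi_indices ms. pure_tensor (w J) I)"
      by (rule sum.reindex_bij_betw[OF h])
    also have "\<dots> = (\<Sum>J\<in>multi_indices ms. if J = I then T I else 0)"
      by (rule sum.cong) (auto simp: w)
    also have "\<dots> = T I"
      using T by (simp add: finite_multi_indices tensor_space_def)
    finally show "T I = (\<Sum>i<card (multi_indices ms). pure_tensor (w (h i)) I)" by simp
  qed
  then show ?thesis
    unfolding is_sum_of_pure_tensors_def
    by (intro exI[of _ "card (multi_indices ms)"] exI[of _ "\<lambda>i. w (h i)"]) (simp add: dim)
qed

lemma zariski_closure_superset: "A \<subseteq> zariski_closure ms A"
  by (auto simp: zariski_closure_def)

lemma det_tensor_in_tensor_space: "det_tensor n \<in> tensor_space (replicate n n)"
  by (auto simp: det_tensor_def tensor_space_def pure_tensor_def comp_def map_replicate_const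
      intro!: sum.neutral)

lemma perm_tensor_in_tensor_space: "perm_tensor n \<in> tensor_space (replicate n n)"
  by (auto simp: perm_tensor_def tensor_space_def pure_tensor_def comp_def map_replicate_const
      intro!: sum.neutral)

end

theory Submission
  imports Defs "Jordan_Normal_Form.Determinant" "HOL-Library.Function_Algebras" "HOL-Library.Countable"
begin

text \<open>
  The lower bound comes from a Koszul-type flattening.  A vector \<open>v\<close> in the \<open>j\<close>-th factor acts by
  \<open>v \<and> _ : \<Lambda>\<^sup>j V \<rightarrow> \<Lambda>\<^sup>j\<^sup>+\<^sup>1 V\<close>, so that a tensor \<open>T\<close> gives a linear map from
  \<open>\<Otimes>\<^sub>j \<Lambda>\<^sup>j V\<close> to \<open>\<Otimes>\<^sub>j \<Lambda>\<^sup>j\<^sup>+\<^sup>1 V\<close> (\<open>0 \<le> j < n\<close>).  Both spaces have dimension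
  \<open>N = \<Prod>\<^sub>j (n choose j)\<close>, a pure tensor gives a map of rank at most \<open>r = \<Prod>\<^sub>j (n - 1 choose j)\<close>, and
  \<open>N / r = n\<^sup>n / n! = n\<^sup>n\<^sup>-\<^sup>1 / (n - 1)!\<close>.  Hence the determinant of this \<open>N \<times> N\<close> matrix is a polynomial
  that vanishes on all tensors of rank at most \<open>k\<close> as soon as \<open>k r < N\<close>.  It does not vanish at
  \<open>det\<^sub>n\<close>: adding one more slot filled with \<open>e\<^sub>1 \<and> \<dots> \<and> e\<^sub>n\<close>, the flattening of \<open>det\<^sub>n\<close> is, up to sign,
  the composition of the operators moving one vector from the extra slot into the slots
  \<open>n - 1, \<dots>, 0\<close>.  Each of them maps weight \<open>-1\<close> to weight \<open>1\<close> for an action of \<open>sl\<^sub>2\<close>, and is therefore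
  injective in characteristic \<open>0\<close>.  The upper bound for the permanent is Glynn's formula.
\<close>

section \<open>Linear operators on function spaces\<close>

text \<open>Pointwise evaluation would turn eta-expanded equations such as \<open>L f = (\<lambda>x. 0 x)\<close> into \<open>L f = (\<lambda>x. 0)\<close>.\<close>

declare zero_fun_apply [simp del] plus_fun_apply [simp del] minus_apply [simp del] uminus_apply [simp del]

lemmas fun_apply = zero_fun_apply plus_fun_apply minus_apply uminus_apply

lemma sum_fun_apply: "sum f A x = (\<Sum>a\<in>A. f a x)"
  by (induction A rule: infinite_finite_induct) (auto simp: fun_apply)

definition smul :: "'a::times \<Rightarrow> ('b \<Rightarrow> 'a) \<Rightarrow> 'b \<Rightarrow> 'a" where
  "smul c f = (\<lambda>x. c * f x)"

definition linop :: "(('b \<Rightarrow> 'a::comm_ring_1) \<Rightarrow> 'c \<Rightarrow> 'a) \<Rightarrow> bool" where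
  "linop L \<longleftrightarrow> (\<forall>f g. L (f + g) = L f + L g) \<and> (\<forall>c f. L (smul c f) = smul c (L f))"

lemma linop_add: "linop L \<Longrightarrow> L (f + g) = L f + L g"
  and linop_smul: "linop L \<Longrightarrow> L (smul c f) = smul c (L f)"
  by (auto simp: linop_def)

lemma linop_zero: "linop L \<Longrightarrow> L 0 = 0"
  using linop_add[of L 0 0] by simp

lemma linop_sum: "linop L \<Longrightarrow> L (sum f A) = (\<Sum>a\<in>A. L (f a))"
  by (induction A rule: infinite_finite_induct) (auto simp: linop_zero linop_add)

lemma linop_neg: "linop L \<Longrightarrow> L (- f) = - L f"
proof -
  assume L: "linop L"
  have "L f + L (- f) = 0"
    unfolding linop_add[OF L, symmetric] add.right_inverse by (rule linop_zero[OF L])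
  then show ?thesis by (rule minus_unique[symmetric])
qed

lemma linop_diff: "linop L \<Longrightarrow> L (f - g) = L f - L g"
  unfolding diff_conv_add_uminus by (simp only: linop_add linop_neg)

lemma smul_simps [simp]:
  "smul 1 f = f" "smul 0 f = 0" "smul c 0 = 0" "smul (- c) f = - smul c f"
  "smul c (- f) = - smul c f" "smul a (smul b f) = smul (a * b) f"
  for f :: "'b \<Rightarrow> 'a::comm_ring_1"
  by (auto simp: smul_def fun_eq_iff fun_apply algebra_simps)

lemma smul_sum: "smul c (sum f A) = (\<Sum>a\<in>A. smul c (f a))"
  for f :: "'c \<Rightarrow> 'b \<Rightarrow> 'a::comm_ring_1"
  by (auto simp: smul_def fun_eq_iff fun_apply sum_fun_apply sum_distrib_left)

lemma smul_diff: "smul c (f - g) = smul c f - smul c g"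
  for f :: "'b \<Rightarrow> 'a::comm_ring_1"
  by (auto simp: smul_def fun_eq_iff fun_apply algebra_simps)

lemma linop_comp: "linop L \<Longrightarrow> linop K \<Longrightarrow> linop (\<lambda>f. L (K f))"
  by (auto simp: linop_def)

lemma linop_smulI: "linop L \<Longrightarrow> linop (\<lambda>f. smul c (L f))"
  by (auto simp: linop_def smul_def fun_eq_iff fun_apply algebra_simps)

lemma linop_sumI: "(\<And>a. a \<in> A \<Longrightarrow> linop (L a)) \<Longrightarrow> linop (\<lambda>f. \<Sum>a\<in>A. L a f)"
  by (auto simp: linop_def sum.distrib smul_sum intro!: sum.cong)

lemma linop_foldr: "(\<And>x. linop (L x)) \<Longrightarrow> linop (foldr L xs)"
  by (induction xs) (auto simp: linop_def)

section \<open>Creation and annihilation operators\<close>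

text \<open>
  A function on sets of modes is an element of the exterior algebra over all modes, in the basis of
  wedge monomials ordered by \<^const>\<open>to_nat\<close>.
\<close>

definition sg :: "'q::countable \<Rightarrow> 'q set \<Rightarrow> 'a::comm_ring_1" where
  "sg q X = (- 1) ^ card {x \<in> X. to_nat x < to_nat q}"

text \<open>\<open>cr q\<close> is left exterior multiplication by the basis vector
  \<open>q\<close>, and \<open>an\<close> below is the matching contraction; \<open>sg\<close>
  counts the smaller modes that \<open>q\<close> has to pass.\<close>

definition cr :: "'q::countable \<Rightarrow> ('q set \<Rightarrow> 'a::comm_ring_1) \<Rightarrow> 'q set \<Rightarrow> 'a" where
  "cr q f = (\<lambda>X. if q \<in> X then sg q X * f (X - {q}) else 0)"

definition an :: "'q::countable \<Rightarrow> ('q set \<Rightarrow> 'a::comm_ring_1) \<Rightarrow> 'q set \<Rightarrow> 'a" where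
  "an q f = (\<lambda>X. if q \<notin> X then sg q X * f (insert q X) else 0)"

lemma linop_cr: "linop (cr q)" and linop_an: "linop (an q)"
  by (auto simp: linop_def cr_def an_def smul_def fun_eq_iff fun_apply algebra_simps)

text \<open>Sets of modes may be infinite, but only finitely many modes precede \<open>q\<close> in
  the enumeration, so the exponent in \<open>sg\<close> is always a genuine count.\<close>

lemma finite_lower: "finite {x \<in> X. to_nat x < to_nat (q::'q::countable)}"
  by (rule finite_imageD[of to_nat], rule finite_subset[of _ "{..<to_nat q}"]) (auto intro: inj_onI)

lemma sg_self [simp]: "sg q (insert q X) = sg q X" "sg q (X - {q}) = sg q X"
  unfolding sg_def by (auto intro!: arg_cong[where f = "\<lambda>A. (- 1) ^ card A"])

lemma sg_sq [simp]: "sg q X * sg q X = 1" "sg q X * (sg q X * c) = c"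
  by (auto simp: sg_def simp flip: mult.assoc power_mult_distrib)

lemma sg_insert:
  assumes "p \<notin> X" "p \<noteq> q"
  shows "sg q (insert p X) = (if to_nat p < to_nat q then - sg q X else sg q X)"
proof (cases "to_nat p < to_nat q")
  case True
  then have "{x \<in> insert p X. to_nat x < to_nat q} = insert p {x \<in> X. to_nat x < to_nat q}"
    by auto
  then show ?thesis using True assms finite_lower[of X q] by (simp add: sg_def)
next
  case False
  then have "{x \<in> insert p X. to_nat x < to_nat q} = {x \<in> X. to_nat x < to_nat q}" by auto
  then show ?thesis using False by (simp add: sg_def)
qed

lemma sg_remove:
  assumes "p \<in> X" "p \<noteq> q"
  shows "sg q (X - {p}) = (if to_nat p < to_nat q then - sg q X else sg q X)"
  by (metis Diff_iff assms insertI1 insert_Diff minus_equation_iff sg_insert)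

lemma to_nat_less_cases: "p \<noteq> q \<Longrightarrow> to_nat p < to_nat q \<longleftrightarrow> \<not> to_nat q < to_nat p"
  by (metis less_asym linorder_neqE_nat to_nat_split)

lemma cr_cr: "cr p (cr q f) = - cr q (cr p f)"
proof (cases "p = q")
  case True then show ?thesis by (auto simp: cr_def fun_eq_iff fun_apply)
next
  case False
  have [simp]: "X - {p} - {q} = X - {q} - {p}" for X by auto
  show ?thesis using False to_nat_less_cases[OF False]
    by (auto simp: cr_def fun_eq_iff fun_apply sg_remove)
qed

lemma an_an: "an p (an q f) = - an q (an p f)"
proof (cases "p = q")
  case True then show ?thesis by (auto simp: an_def fun_eq_iff fun_apply)
next
  case False
  show ?thesis using False to_nat_less_cases[OF False]
    by (auto simp: an_def fun_eq_iff fun_apply sg_insert insert_commute)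
qed

lemma an_an_same [simp]: "an q (an q f) = 0"
  by (auto simp: an_def fun_eq_iff fun_apply)

text \<open>The canonical anticommutation relation. For \<open>p = q\<close> exactly one of the two
  products survives at \<open>X\<close>, according to whether \<open>q\<close> lies in
  \<open>X\<close>; otherwise the two signs differ because one of \<open>p\<close>, \<open>q\<close>
  precedes the other.\<close>

lemma an_cr: "an p (cr q f) = (if p = q then f else 0) - cr q (an p f)"
proof (cases "p = q")
  case True then show ?thesis by (auto simp: cr_def an_def fun_eq_iff fun_apply insert_absorb)
next
  case False
  have [simp]: "insert p X - {q} = insert p (X - {q})" for X using False by auto
  show ?thesis using False to_nat_less_cases[OF False]
    by (auto simp: an_def cr_def fun_eq_iff fun_apply sg_insert sg_remove)
qed

lemma cr_an_same: "cr q (an q f) X = (if q \<in> X then f X else 0)"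
  by (auto simp: cr_def an_def insert_absorb)

lemmas linop_foldr_cr = linop_foldr[of cr, OF linop_cr]
lemmas linop_foldr_an = linop_foldr[of an, OF linop_an]
lemmas cr_lin = linop_add[OF linop_cr] linop_smul[OF linop_cr] linop_zero[OF linop_cr]
  linop_neg[OF linop_cr] linop_diff[OF linop_cr] linop_sum[OF linop_cr]
lemmas an_lin = linop_add[OF linop_an] linop_smul[OF linop_an] linop_zero[OF linop_an]
  linop_neg[OF linop_an] linop_diff[OF linop_an] linop_sum[OF linop_an]
lemmas foldr_an_lin = linop_smul[OF linop_foldr_an] linop_zero[OF linop_foldr_an] linop_neg[OF linop_foldr_an]

lemma an_foldr_an: "an p (foldr an ps f) = smul ((- 1) ^ length ps) (foldr an ps (an p f))"
proof (induction ps)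
  case (Cons q ps)
  then show ?case by (simp add: an_an[of p q] an_lin)
qed simp

lemma foldr_an_cr: "q \<notin> set ps \<Longrightarrow> foldr an ps (cr q f) = smul ((- 1) ^ length ps) (cr q (foldr an ps f))"
proof (induction ps)
  case (Cons p ps)
  then show ?case by (auto simp: an_cr an_lin)
qed simp

lemma foldr_an_repeat: "foldr an (ps @ p # qs @ p # rs) f = 0"
  by (simp add: an_foldr_an an_lin foldr_an_lin)

lemma foldr_an_swap:
  "foldr an (ps @ p # qs @ p' # rs) f = - foldr an (ps @ p' # qs @ p # rs) f"
  by (simp add: an_foldr_an an_an[of p p'] an_lin foldr_an_lin mult.assoc)

lemma foldr_cr_nonzero:
  "foldr cr qs f X \<noteq> 0 \<Longrightarrow> set qs \<subseteq> X \<and> f (X - set qs) \<noteq> 0"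
proof (induction qs arbitrary: X)
  case (Cons q qs)
  then have "q \<in> X" "foldr cr qs f (X - {q}) \<noteq> 0" by (auto simp: cr_def[of q] split: if_splits)
  with Cons.IH[of "X - {q}"] have "set qs \<subseteq> X - {q}" "f (X - {q} - set qs) \<noteq> 0" by blast+
  moreover have "X - {q} - set qs = X - set (q # qs)" by auto
  ultimately show ?case using \<open>q \<in> X\<close> by auto
qed simp

text \<open>The reversal puts each creator next to the annihilator of the same mode, so the pairs
  cancel from the inside without a sign.\<close>

lemma foldr_an_rev_cr:
  assumes "distinct qs" "\<And>q. q \<in> set qs \<Longrightarrow> an q f = 0"
  shows "foldr an qs (foldr cr (rev qs) f) = f"
  using assms
proof (induction qs arbitrary: f)
  case (Cons q qs)
  have "foldr an (q # qs) (foldr cr (rev (q # qs)) f) = an q (foldr an qs (foldr cr (rev qs) (cr q f)))"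
    by simp
  also have "foldr an qs (foldr cr (rev qs) (cr q f)) = cr q f"
  proof (rule Cons.IH)
    fix p assume p: "p \<in> set qs"
    then have "an p f = 0" "p \<noteq> q" using Cons.prems by auto
    then show "an p (cr q f) = 0" by (simp add: an_cr cr_lin)
  qed (use Cons.prems in auto)
  also have "an q (cr q f) = f" using Cons.prems(2)[of q] by (simp add: an_cr cr_lin)
  finally show ?case .
qed simp

section \<open>Moving a vector between slots\<close>

text \<open>The mode \<open>(i, j)\<close> is the basis vector \<open>e\<^sub>i\<close> in the \<open>j\<close>-th tensor slot.\<close>

type_synonym mode = "nat \<times> nat"

text \<open>The polarization operator that moves one vector from slot \<open>k\<close> to slot
  \<open>j\<close>. Together with \<open>shift n k j\<close> it generates the sl_2 acting on this
  pair of slots.\<close>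

definition shift :: "nat \<Rightarrow> nat \<Rightarrow> nat \<Rightarrow> (mode set \<Rightarrow> 'a::comm_ring_1) \<Rightarrow> mode set \<Rightarrow> 'a" where
  "shift n j k f = (\<Sum>i<n. cr (i, j) (an (i, k) f))"

text \<open>The degree in slot \<open>j\<close>. Bounding \<open>i\<close> by \<open>n\<close> keeps
  the count finite even on infinite sets of modes.\<close>

definition occ :: "nat \<Rightarrow> nat \<Rightarrow> mode set \<Rightarrow> nat" where
  "occ n j X = card {i. i < n \<and> (i, j) \<in> X}"

definition homog :: "nat \<Rightarrow> nat \<Rightarrow> nat \<Rightarrow> (mode set \<Rightarrow> 'a::zero) \<Rightarrow> bool" where
  "homog n j d f \<longleftrightarrow> (\<forall>X. f X \<noteq> 0 \<longrightarrow> occ n j X = d)"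

lemma linop_shift: "linop (shift n j k)"
  unfolding shift_def by (intro linop_sumI linop_comp[of "cr _" "an _"] linop_cr linop_an)

lemma number_op: "(\<Sum>i<n. cr (i, j) (an (i, j) f)) X = of_nat (occ n j X) * f X"
proof -
  have "(\<Sum>i<n. cr (i, j) (an (i, j) f)) X = (\<Sum>i | i < n \<and> (i, j) \<in> X. f X)"
    by (simp add: sum_fun_apply cr_an_same sum.inter_filter[symmetric] lessThan_def)
  then show ?thesis by (simp add: occ_def)
qed

lemma number_op_homog:
  assumes "homog n j d f"
  shows "(\<Sum>i<n. cr (i, j) (an (i, j) f)) = smul (of_nat d) f"
proof
  fix X
  show "(\<Sum>i<n. cr (i, j) (an (i, j) f)) X = smul (of_nat d) f X"
    using assms unfolding number_op by (cases "f X = 0") (auto simp: smul_def homog_def)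
qed

lemma homog_sum: "(\<And>i. i \<in> A \<Longrightarrow> homog n j d (f i)) \<Longrightarrow> homog n j d (sum f A)"
  unfolding homog_def sum_fun_apply by (metis sum.neutral)

lemma occ_insert: "i < n \<Longrightarrow> (i, k) \<notin> X \<Longrightarrow> occ n j (insert (i, k) X) = (if j = k then Suc (occ n j X) else occ n j X)"
proof -
  assume *: "i < n" "(i, k) \<notin> X"
  have "{i'. i' < n \<and> (i', j) \<in> insert (i, k) X} =
    (if j = k then insert i {i'. i' < n \<and> (i', j) \<in> X} else {i'. i' < n \<and> (i', j) \<in> X})"
    using * by auto
  then show ?thesis using * by (simp add: occ_def)
qed

lemma homog_cr:
  assumes "homog n j d f" "i < n"
  shows "homog n j (if j = k then Suc d else d) (cr (i, k) f)"
  unfolding homog_def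
proof (intro allI impI)
  fix X assume "cr (i, k) f X \<noteq> 0"
  then have X: "(i, k) \<in> X" "f (X - {(i, k)}) \<noteq> 0" by (auto simp: cr_def split: if_splits)
  then have "occ n j (X - {(i, k)}) = d" using assms by (auto simp: homog_def)
  moreover have "insert (i, k) (X - {(i, k)}) = X" using X by auto
  ultimately show "occ n j X = (if j = k then Suc d else d)"
    using occ_insert[of i n k "X - {(i, k)}" j] assms(2) by auto
qed

lemma homog_an:
  assumes "homog n j (if j = k then Suc d else d) f" "i < n"
  shows "homog n j d (an (i, k) f)"
  unfolding homog_def
proof (intro allI impI)
  fix X assume "an (i, k) f X \<noteq> 0"
  then have X: "(i, k) \<notin> X" "f (insert (i, k) X) \<noteq> 0" by (auto simp: an_def split: if_splits)
  then have "occ n j (insert (i, k) X) = (if j = k then Suc d else d)"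
    using assms by (auto simp: homog_def)
  then show "occ n j X = d"
    using occ_insert[of i n k X j] X assms(2) by (auto split: if_splits)
qed

lemma homog_shift:
  assumes "j \<noteq> k"
  shows "homog n j d f \<Longrightarrow> homog n j (Suc d) (shift n j k f)"
    and "homog n k (Suc d) f \<Longrightarrow> homog n k d (shift n j k f)"
    and "l \<noteq> j \<Longrightarrow> l \<noteq> k \<Longrightarrow> homog n l d f \<Longrightarrow> homog n l d (shift n j k f)"
proof -
  show "homog n j (Suc d) (shift n j k f)" if "homog n j d f"
    unfolding shift_def
  proof (rule homog_sum)
    fix i assume "i \<in> {..<n}"
    then show "homog n j (Suc d) (cr (i, j) (an (i, k) f))"
      using that assms homog_an[of n j k d f i] homog_cr[of n j d "an (i, k) f" i j] by simp
  qed
  show "homog n k d (shift n j k f)" if "homog n k (Suc d) f"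
    unfolding shift_def
  proof (rule homog_sum)
    fix i assume "i \<in> {..<n}"
    then show "homog n k d (cr (i, j) (an (i, k) f))"
      using that assms homog_an[of n k k d f i] homog_cr[of n k d "an (i, k) f" i j] by simp
  qed
  show "homog n l d (shift n j k f)" if "l \<noteq> j" "l \<noteq> k" "homog n l d f"
    unfolding shift_def
  proof (rule homog_sum)
    fix i assume "i \<in> {..<n}"
    then show "homog n l d (cr (i, j) (an (i, k) f))"
      using that assms homog_an[of n l k d f i] homog_cr[of n l d "an (i, k) f" i j] by simp
  qed
qed

lemma an_homog_0: assumes "homog n k 0 f" "i < n" shows "an (i, k) f = 0"
proof
  fix X
  have "f (insert (i, k) X) = 0" if "(i, k) \<notin> X"
    using assms that occ_insert[of i n k X k] by (auto simp: homog_def)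
  then show "an (i, k) f X = 0 X" by (auto simp: an_def fun_apply)
qed

lemma shift_homog_0: "homog n k 0 f \<Longrightarrow> shift n j k f = 0"
  unfolding shift_def by (rule sum.neutral) (auto simp: an_homog_0 cr_lin)

text \<open>The relation [E, F] = H of sl_2, with H the difference of the two number operators.
  Normal ordering leaves the contractions \<open>i = l\<close>, which give the number operators, and
  quartic terms that agree on both sides.\<close>

lemma shift_commutator:
  assumes "j \<noteq> k"
  shows "shift n j k (shift n k j f) = shift n k j (shift n j k f)
    + (\<Sum>i<n. cr (i, j) (an (i, j) f)) - (\<Sum>i<n. cr (i, k) (an (i, k) f))"
proof -
  have 1: "shift n j k (shift n k j f) =
      (\<Sum>i<n. \<Sum>l<n. (if i = l then cr (i, j) (an (l, j) f) else 0)
        - cr (i, j) (cr (l, k) (an (i, k) (an (l, j) f))))" for j k :: nat and f :: "mode set \<Rightarrow> 'a"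
    unfolding shift_def
    by (intro sum.cong refl) (auto simp: cr_lin an_lin an_cr intro!: sum.cong)
  \<comment> \<open>Exchanging the summation indices and then both the creators and the annihilators
    costs two signs, which cancel.\<close>
  have 2: "(\<Sum>i<n. \<Sum>l<n. cr (i, j) (cr (l, k) (an (i, k) (an (l, j) f))))
    = (\<Sum>i<n. \<Sum>l<n. cr (i, k) (cr (l, j) (an (i, j) (an (l, k) f))))"
    by (subst sum.swap, intro sum.cong refl, subst cr_cr, subst an_an) (simp add: cr_lin)
  show ?thesis
    unfolding 1 sum_subtractf 2 by simp
qed

text \<open>
  For \<open>E = shift n j k\<close> and \<open>F = shift n k j\<close>, the kernel condition \<open>E f = 0\<close> forces
  \<open>E F\<^sup>s\<^sup>+\<^sup>1 f = - (s + 1)\<^sup>2 F\<^sup>s f\<close>, whereas \<open>F\<close> is nilpotent on \<open>f\<close>.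
\<close>

lemma shift_injective:
  fixes f :: "mode set \<Rightarrow> 'a::field_char_0"
  assumes jk: "j \<noteq> k" and j: "homog n j d f" and k: "homog n k (Suc d) f"
    and zero: "shift n j k f = 0"
  shows "f = 0"
proof -
  define F where "F s = (shift n k j ^^ s) f" for s
  have F_Suc: "F (Suc s) = shift n k j (F s)" for s by (simp add: F_def)
  have hom: "homog n j (d - s) (F s) \<and> homog n k (Suc d + s) (F s)" if "s \<le> d" for s
    using that
  proof (induction s)
    case (Suc s)
    then have "homog n j (Suc (d - Suc s)) (F s)" "homog n k (Suc d + s) (F s)"
      by (auto simp: Suc_diff_Suc)
    then show ?case
      unfolding F_Suc using jk homog_shift(1)[of k j n "Suc d + s" "F s"]
        homog_shift(2)[of k j n "d - Suc s" "F s"] by auto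
  qed (simp add: F_def j k)
  have EF: "shift n j k (F (Suc s)) = smul (- (of_nat (Suc s))\<^sup>2) (F s)" if "s \<le> d" for s
    using that
  proof (induction s)
    case 0
    have "shift n j k (shift n k j f) = smul (of_nat d) f - smul (of_nat (Suc d)) f"
      unfolding shift_commutator[OF jk] zero linop_zero[OF linop_shift]
        number_op_homog[OF j] number_op_homog[OF k] by simp
    then show ?case
      by (auto simp: F_def smul_def fun_eq_iff fun_apply algebra_simps)
  next
    case (Suc s)
    have *: "shift n j k (F (Suc s)) = smul (- (of_nat (Suc s))\<^sup>2) (F s)" using Suc by simp
    \<comment> \<open>The commutator contributes (d - (s + 1)) - (d + s + 2) = -(2 s + 3) on
      \<open>F (Suc s)\<close>, which turns -(s + 1)^2 into -(s + 2)^2.\<close>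
    have "shift n j k (F (Suc (Suc s))) = shift n k j (shift n j k (F (Suc s)))
        + smul (of_nat (d - Suc s)) (F (Suc s)) - smul (of_nat (Suc d + Suc s)) (F (Suc s))"
      unfolding F_Suc[of "Suc s"] shift_commutator[OF jk]
        number_op_homog[OF conjunct1[OF hom[OF Suc.prems]]]
        number_op_homog[OF conjunct2[OF hom[OF Suc.prems]]] ..
    also have "shift n k j (shift n j k (F (Suc s))) = smul (- (of_nat (Suc s))\<^sup>2) (F (Suc s))"
      by (simp only: * linop_smul[OF linop_shift] F_Suc[of s, symmetric])
    finally show ?case using Suc.prems
      by (auto simp: smul_def fun_eq_iff fun_apply of_nat_diff algebra_simps power2_eq_square)
  qed
  \<comment> \<open>After \<open>d\<close> moves slot \<open>j\<close> is empty, so one more move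
    out of it gives zero.\<close>
  have top: "F (Suc d) = 0"
    unfolding F_Suc using hom[of d] by (intro shift_homog_0) simp
  \<comment> \<open>Descending from \<open>top\<close>: the square factor in \<open>EF\<close> is
    nonzero in characteristic 0, so each vanishing \<open>F (Suc s)\<close> forces
    \<open>F s\<close> to vanish, down to \<open>F 0 = f\<close>.\<close>
  have "F (d - s) = 0" if "s \<le> d" for s
    using that
  proof (induction s)
    case 0
    have "smul (- (of_nat (Suc d))\<^sup>2) (F d) = 0"
      using EF[of d] top by (simp add: linop_zero[OF linop_shift])
    then show ?case by (auto simp: smul_def fun_eq_iff fun_apply simp del: of_nat_Suc)
  next
    case (Suc s)
    then have "F (Suc (d - Suc s)) = 0" by (simp add: Suc_diff_Suc)
    then have "smul (- (of_nat (Suc (d - Suc s)))\<^sup>2) (F (d - Suc s)) = 0"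
      using EF[of "d - Suc s"] by (simp only: linop_zero[OF linop_shift])
    then show ?case by (auto simp: smul_def fun_eq_iff fun_apply simp del: of_nat_Suc)
  qed
  from this[of d] show ?thesis by (simp add: F_def)
qed

section \<open>The flattening of a tensor\<close>

definition words :: "nat \<Rightarrow> nat \<Rightarrow> nat list set" where
  "words n m = {I. length I = m \<and> set I \<subseteq> {..<n}}"

lemma words_0: "words n 0 = {[]}"
  by (auto simp: words_def)

lemma sum_words_Suc: "(\<Sum>I\<in>words n (Suc m). F I) = (\<Sum>I\<in>words n m. \<Sum>i<n. F (I @ [i]))"
proof -
  have "words n (Suc m) = (\<lambda>(I, i). I @ [i]) ` (words n m \<times> {..<n})"
  proof (intro equalityI subsetI)
    fix I assume "I \<in> words n (Suc m)"
    then have I: "length I = Suc m" "set I \<subseteq> {..<n}" by (auto simp: words_def)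
    then have "I \<noteq> []" by auto
    then obtain I' i where "I = I' @ [i]" by (metis append_butlast_last_id)
    then show "I \<in> (\<lambda>(I, i). I @ [i]) ` (words n m \<times> {..<n})"
      using I by (auto simp: words_def)
  qed (auto simp: words_def)
  then show ?thesis
    by (simp add: sum.reindex inj_on_def sum.cartesian_product case_prod_unfold)
qed

lemma multi_indices_replicate: "multi_indices (replicate n n) = words n n"
  by (auto simp: multi_indices_def words_def list_all2_conv_all_nth in_set_conv_nth subset_iff)

text \<open>Multilinear expansion into all choices of one summand per slot. It serves both the
  wedges of a pure tensor and the shifts.\<close>

lemma foldr_sum_words:
  assumes "\<And>i j. linop (L i j)"
  shows "foldr (\<lambda>j g. \<Sum>i<n. L i j g) [0..<m] f
    = (\<Sum>I\<in>words n m. foldr (\<lambda>(i, j). L i j) (zip I [0..<m]) f)"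
proof (induction m arbitrary: f)
  case 0
  then show ?case by (simp add: words_0)
next
  case (Suc m)
  have lin: "linop (foldr (\<lambda>(i, j). L i j) xs)" for xs
    using assms by (intro linop_foldr) (auto split: prod.split)
  have "foldr (\<lambda>j g. \<Sum>i<n. L i j g) [0..<Suc m] f
    = (\<Sum>I\<in>words n m. foldr (\<lambda>(i, j). L i j) (zip I [0..<m]) (\<Sum>i<n. L i m f))"
    by (simp add: Suc.IH)
  also have "\<dots> = (\<Sum>I\<in>words n m. \<Sum>i<n. foldr (\<lambda>(i, j). L i j) (zip I [0..<m]) (L i m f))"
    by (simp only: linop_sum[OF lin])
  also have "\<dots> = (\<Sum>I\<in>words n (Suc m). foldr (\<lambda>(i, j). L i j) (zip I [0..<Suc m]) f)"
    unfolding sum_words_Suc by (intro sum.cong refl) (auto simp: words_def)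
  finally show ?case .
qed

text \<open>The flattening in coordinates: the basis tensor of a word \<open>I\<close> wedges its
  \<open>j\<close>-th letter into slot \<open>j\<close>. Linearity in \<open>T\<close> is thus
  visible from the formula.\<close>

definition flat :: "nat \<Rightarrow> 'a::comm_ring_1 tensor \<Rightarrow> (mode set \<Rightarrow> 'a) \<Rightarrow> mode set \<Rightarrow> 'a" where
  "flat n T f = (\<Sum>I\<in>words n n. smul (T I) (foldr cr (zip I [0..<n]) f))"

definition wedge :: "nat \<Rightarrow> 'a::comm_ring_1 vec \<Rightarrow> nat \<Rightarrow> (mode set \<Rightarrow> 'a) \<Rightarrow> mode set \<Rightarrow> 'a" where
  "wedge n v j f = (\<Sum>i<n. smul (v $ i) (cr (i, j) f))"

lemma linop_wedge: "linop (wedge n v j)"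
  unfolding wedge_def by (intro linop_sumI linop_smulI linop_cr)

lemma foldr_smul_cr:
  "foldr (\<lambda>(i, j) f. smul (c j i) (cr (i, j) f)) (zip I [0..<length I]) f
    = smul (\<Prod>j<length I. c j (I ! j)) (foldr cr (zip I [0..<length I]) f)"
proof (induction I arbitrary: f rule: rev_induct)
  case (snoc i I)
  then show ?case
    by (simp add: linop_smul[OF linop_foldr_cr] nth_append mult.commute cong: prod.cong_simp)
qed simp

lemma flat_pure_tensor:
  assumes "map dim_vec vs = replicate n n"
  shows "flat n (pure_tensor vs) f = foldr (\<lambda>j. wedge n (vs ! j) j) [0..<n] f"
proof -
  have n: "length vs = n" using assms by (metis length_map length_replicate)
  have "foldr (\<lambda>j. wedge n (vs ! j) j) [0..<n] f
    = (\<Sum>I\<in>words n n. foldr (\<lambda>(i, j) f. smul (vs ! j $ i) (cr (i, j) f)) (zip I [0..<n]) f)"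
    unfolding wedge_def by (intro foldr_sum_words linop_smulI linop_cr)
  also have "\<dots> = flat n (pure_tensor vs) f"
    unfolding flat_def
  proof (rule sum.cong[OF refl])
    fix I assume I: "I \<in> words n n"
    then have l: "length I = n" by (simp add: words_def)
    have "pure_tensor vs I = (\<Prod>j<n. vs ! j $ (I ! j))"
      using I unfolding pure_tensor_def assms multi_indices_replicate by (simp add: n)
    then show "foldr (\<lambda>(i, j) f. smul (vs ! j $ i) (cr (i, j) f)) (zip I [0..<n]) f
      = smul (pure_tensor vs I) (foldr cr (zip I [0..<n]) f)"
      using foldr_smul_cr[of "\<lambda>j i. vs ! j $ i" I f] l by simp
  qed
  finally show ?thesis ..
qed

text \<open>All creators are sorted to the left of all annihilators. The creator in slot
  \<open>j\<close> passes the \<open>j\<close> annihilators to its left, hence the exponent;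
  \<open>length I \<le> u\<close> keeps slot \<open>u\<close> apart from the slots being filled, so
  no contraction terms arise.\<close>

lemma foldr_cr_an:
  assumes "length I \<le> u"
  shows "foldr (\<lambda>(i, j) f. cr (i, j) (an (i, u) f)) (zip I [0..<length I]) f
    = smul ((- 1) ^ (\<Sum>j<length I. j))
        (foldr cr (zip I [0..<length I]) (foldr an (map (\<lambda>i. (i, u)) I) f))"
  using assms
proof (induction I arbitrary: f rule: rev_induct)
  case (snoc i I)
  have "foldr an (map (\<lambda>i. (i, u)) I) (cr (i, length I) (an (i, u) f))
    = smul ((- 1) ^ length I) (cr (i, length I) (foldr an (map (\<lambda>i. (i, u)) I) (an (i, u) f)))"
    using snoc.prems by (subst foldr_an_cr) auto
  with snoc show ?case
    by (simp add: linop_smul[OF linop_foldr_cr] power_add)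
qed simp

lemma foldr_shift:
  "foldr (\<lambda>j. shift n j n) [0..<n] f = smul ((- 1) ^ (\<Sum>j<n. j))
    (\<Sum>I\<in>words n n. foldr cr (zip I [0..<n]) (foldr an (map (\<lambda>i. (i, n)) I) f))"
proof -
  have "foldr (\<lambda>j. shift n j n) [0..<n] f
    = (\<Sum>I\<in>words n n. foldr (\<lambda>(i, j) f. cr (i, j) (an (i, n) f)) (zip I [0..<n]) f)"
    unfolding shift_def by (intro foldr_sum_words linop_comp[of "cr _" "an _"] linop_cr linop_an)
  also have "\<dots> = (\<Sum>I\<in>words n n. smul ((- 1) ^ (\<Sum>j<n. j))
    (foldr cr (zip I [0..<n]) (foldr an (map (\<lambda>i. (i, n)) I) f)))"
  proof (rule sum.cong[OF refl])
    fix I assume "I \<in> words n n"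
    then have "length I = n" by (simp add: words_def)
    then show "foldr (\<lambda>(i, j) f. cr (i, j) (an (i, n) f)) (zip I [0..<n]) f
      = smul ((- 1) ^ (\<Sum>j<n. j)) (foldr cr (zip I [0..<n]) (foldr an (map (\<lambda>i. (i, n)) I) f))"
      using foldr_cr_an[of I n f] by simp
  qed
  finally show ?thesis by (simp add: smul_sum)
qed

text \<open>The innermost shift goes into the last slot of the list. If that slot is
  \<open>m\<close>, it has degree \<open>m\<close> and slot \<open>n\<close> has degree
  \<open>m + 1\<close>, which is exactly the situation of \<open>shift_injective\<close>; afterwards
  slot \<open>n\<close> has degree \<open>m\<close> and the induction continues.\<close>

lemma foldr_shift_injective:
  fixes f :: "mode set \<Rightarrow> 'a::field_char_0"
  assumes "m \<le> n" "\<And>j. j < m \<Longrightarrow> homog n j j f" "homog n n m f"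
    and "foldr (\<lambda>j. shift n j n) [0..<m] f = 0"
  shows "f = 0"
  using assms
proof (induction m arbitrary: f)
  case (Suc m)
  have "shift n m n f = 0"
  proof (rule Suc.IH)
    show "homog n j j (shift n m n f)" if "j < m" for j
      using that Suc.prems by (intro homog_shift(3)) auto
    show "homog n n m (shift n m n f)"
      using Suc.prems by (intro homog_shift(2)) auto
  qed (use Suc.prems in auto)
  then show ?case
    using Suc.prems by (intro shift_injective[of m n n m f]) auto
qed simp

text \<open>Puts the full wedge of all basis vectors into the extra slot \<open>n\<close>. The order
  is reversed so that annihilating along the increasing list restores \<open>f\<close> without a
  sign.\<close>

definition fill :: "nat \<Rightarrow> (mode set \<Rightarrow> 'a::comm_ring_1) \<Rightarrow> mode set \<Rightarrow> 'a" where
  "fill n f = foldr cr (rev (map (\<lambda>i. (i, n)) [0..<n])) f"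

lemma foldr_an_fill:
  assumes "homog n n 0 f"
  shows "foldr an (map (\<lambda>i. (i, n)) [0..<n]) (fill n f) = f"
  unfolding fill_def using assms
  by (intro foldr_an_rev_cr) (auto simp: distinct_map inj_on_def an_homog_0)

lemma homog_fill:
  assumes "homog n n 0 f"
  shows "homog n n n (fill n f)"
proof -
  have "homog n n m (foldr cr (rev (map (\<lambda>i. (i, n)) [0..<m])) f)" if "m \<le> n" for m
    using that
  proof (induction m)
    case (Suc m)
    then show ?case using homog_cr[of n n m _ m n] by simp
  qed (simp add: assms)
  then show ?thesis by (simp add: fill_def)
qed

lemma homog_fill_other:
  assumes "homog n j d f" "j \<noteq> n"
  shows "homog n j d (fill n f)"
proof -
  have "homog n j d (foldr cr (rev (map (\<lambda>i. (i, n)) [0..<m])) f)" if "m \<le> n" for m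
    using that
  proof (induction m)
    case (Suc m)
    then show ?case using homog_cr[of n j d _ m n] assms by simp
  qed (simp add: assms)
  then show ?thesis by (simp add: fill_def)
qed

section \<open>Coordinates of the determinant and permanent tensors, and contractions of the full
  wedge\<close>

lemma pure_tensor_unit_vecs:
  assumes "\<sigma> permutes {..<n}"
  shows "pure_tensor (map (\<lambda>j. unit_vec n (\<sigma> j)) [0..<n]) I = (if I = map \<sigma> [0..<n] then 1 else 0)"
proof -
  have dims: "map dim_vec (map (\<lambda>j. unit_vec n (\<sigma> j)) [0..<n]) = replicate n n"
    by (simp add: map_replicate_const comp_def)
  have s: "\<sigma> j < n" if "j < n" for j using permutes_in_image[OF assms, of j] that by simp
  show ?thesis
  proof (cases "I \<in> words n n")
    case True
    then have I: "length I = n" "\<And>j. j < n \<Longrightarrow> I ! j < n"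
      by (auto simp: words_def subset_iff in_set_conv_nth)
    have "pure_tensor (map (\<lambda>j. unit_vec n (\<sigma> j)) [0..<n]) I = (\<Prod>j<n. if I ! j = \<sigma> j then 1 else 0)"
      using True I s unfolding pure_tensor_def dims multi_indices_replicate
      by (auto intro!: prod.cong)
    also have "\<dots> = (if \<forall>j<n. I ! j = \<sigma> j then 1 else 0)"
      by (auto intro!: prod_zero)
    also have "(\<forall>j<n. I ! j = \<sigma> j) \<longleftrightarrow> I = map \<sigma> [0..<n]"
      using I by (auto simp: list_eq_iff_nth_eq)
    finally show ?thesis .
  next
    case False
    then have "I \<noteq> map \<sigma> [0..<n]" using s by (auto simp: words_def)
    then show ?thesis
      using False unfolding pure_tensor_def dims multi_indices_replicate by simp
  qed
qed

lemma sum_permutations_list: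
  assumes "\<sigma> permutes {..<n}"
  shows "(\<Sum>\<tau> | \<tau> permutes {..<n}. c \<tau> * pure_tensor (map (\<lambda>j. unit_vec n (\<tau> j)) [0..<n]) (map \<sigma> [0..<n]))
    = c \<sigma>"
proof -
  have "\<tau> = \<sigma>" if "\<tau> permutes {..<n}" "map \<sigma> [0..<n] = map \<tau> [0..<n]" for \<tau>
  proof
    fix x show "\<tau> x = \<sigma> x"
    proof (cases "x < n")
      case True
      then show ?thesis using that(2) by auto
    next
      case False
      then show ?thesis using that(1) assms by (simp add: permutes_def)
    qed
  qed
  then have "(\<Sum>\<tau> | \<tau> permutes {..<n}. c \<tau> * pure_tensor (map (\<lambda>j. unit_vec n (\<tau> j)) [0..<n]) (map \<sigma> [0..<n]))
    = (\<Sum>\<tau> | \<tau> permutes {..<n}. if \<tau> = \<sigma> then c \<tau> else 0)"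
    by (intro sum.cong) (auto simp: pure_tensor_unit_vecs)
  then show ?thesis using assms by (simp add: finite_permutations)
qed

lemma det_tensor_permutation:
  "\<sigma> permutes {..<n} \<Longrightarrow> det_tensor n (map \<sigma> [0..<n]) = of_int (sign \<sigma>)"
  unfolding det_tensor_def by (rule sum_permutations_list)

lemma perm_tensor_permutation:
  "\<sigma> permutes {..<n} \<Longrightarrow> perm_tensor n (map \<sigma> [0..<n]) = 1"
  unfolding perm_tensor_def using sum_permutations_list[of \<sigma> n "\<lambda>_. 1"] by simp

lemma not_distinct_tensor:
  assumes "\<not> distinct I"
  shows "det_tensor n I = (0 :: 'a::field)" "perm_tensor n I = (0 :: 'a)"
proof -
  have "pure_tensor (map (\<lambda>j. unit_vec n (\<sigma> j)) [0..<n]) I = (0 :: 'a)" if "\<sigma> permutes {..<n}" for \<sigma>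
  proof -
    have "distinct (map \<sigma> [0..<n])"
      using permutes_inj[OF that] by (simp add: distinct_map inj_on_def)
    then show ?thesis using assms unfolding pure_tensor_unit_vecs[OF that] by auto
  qed
  then show "det_tensor n I = (0 :: 'a)" "perm_tensor n I = (0 :: 'a)"
    unfolding det_tensor_def perm_tensor_def by (auto intro!: sum.neutral)
qed

lemma distinct_word_permutation:
  assumes "I \<in> words n n" "distinct I"
  obtains \<sigma> where "\<sigma> permutes {..<n}" "I = map \<sigma> [0..<n]"
proof -
  define \<sigma> where "\<sigma> j = (if j < n then I ! j else j)" for j
  have I: "length I = n" "set I \<subseteq> {..<n}" using assms by (auto simp: words_def)
  have "card (set I) = n" using I distinct_card[OF assms(2)] by simp
  then have "set I = {..<n}" using I card_subset_eq[of "{..<n}" "set I"] by simp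
  then have "bij_betw (\<lambda>j. I ! j) {..<n} {..<n}"
    using I(1) by (intro bij_betw_nth[OF assms(2)]) auto
  then have "bij_betw \<sigma> {..<n} {..<n}"
    by (rule bij_betw_cong[THEN iffD1, rotated]) (simp add: \<sigma>_def)
  then have "\<sigma> permutes {..<n}" by (rule bij_imp_permutes) (auto simp: \<sigma>_def)
  moreover have "I = map \<sigma> [0..<n]" using I(1) by (intro nth_equalityI) (simp_all add: \<sigma>_def)
  ultimately show ?thesis by (rule that)
qed

lemma upt_split2: "a < b \<Longrightarrow> b < n \<Longrightarrow> [0..<n] = [0..<a] @ a # [Suc a..<b] @ b # [Suc b..<n]"
proof -
  assume ab: "a < b" "b < n"
  have "[0..<n] = [0..<a] @ [a..<n]" using upt_add_eq_append[of 0 a "n - a"] ab by simp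
  moreover have "[a..<n] = a # [Suc a..<n]" using ab by (intro upt_conv_Cons) simp
  moreover have "[Suc a..<n] = [Suc a..<b] @ [b..<n]"
    using upt_add_eq_append[of "Suc a" b "n - b"] ab by simp
  moreover have "[b..<n] = b # [Suc b..<n]" using ab by (intro upt_conv_Cons)
  ultimately show ?thesis by (simp only: append.simps)
qed

text \<open>Composing with a transposition on the right exchanges two positions of the list, which
  costs one sign by \<open>foldr_an_swap\<close>. Induction over transpositions then produces
  \<open>sign \<sigma>\<close>.\<close>

lemma foldr_an_permutation:
  fixes g :: "'q::countable set \<Rightarrow> 'a::comm_ring_1"
  assumes "\<sigma> permutes {..<n}"
  shows "foldr an (map (\<lambda>j. q (\<sigma> j)) [0..<n]) g = smul (of_int (sign \<sigma>)) (foldr an (map q [0..<n]) g)"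
proof -
  have transp: "foldr an (map (\<lambda>j. p (transpose a b j)) [0..<n]) g = - foldr an (map p [0..<n]) g"
    if ab: "a < b" "b < n" for p :: "nat \<Rightarrow> 'q" and a b
  proof -
    have "map (\<lambda>j. p (transpose a b j)) [0..<n]
      = map p [0..<a] @ p b # map p [Suc a..<b] @ p a # map p [Suc b..<n]"
      unfolding upt_split2[OF ab] using ab by (simp add: transpose_def)
    moreover have "map p [0..<n] = map p [0..<a] @ p a # map p [Suc a..<b] @ p b # map p [Suc b..<n]"
      unfolding upt_split2[OF ab] by simp
    ultimately show ?thesis
      using foldr_an_swap[of "map p [0..<a]" "p b" "map p [Suc a..<b]" "p a" "map p [Suc b..<n]" g]
      by (simp only:)
  qed
  have "finite {..<n}" by simp
  from this assms show ?thesis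
  proof (induction rule: permutes_rev_induct)
    case id
    then show ?case by simp
  next
    case (swap a b \<sigma>)
    have sgn: "sign (\<sigma> \<circ> transpose a b) = - sign \<sigma>"
    proof -
      have "permutation \<sigma>" using swap.hyps(4) unfolding permutation_permutes by (intro exI[of _ "{..<n}"]) simp
      then show ?thesis
        using swap.hyps by (simp add: sign_compose permutation_swap_id sign_swap_id)
    qed
    have "foldr an (map (\<lambda>j. q ((\<sigma> \<circ> transpose a b) j)) [0..<n]) g
      = - foldr an (map (\<lambda>j. q (\<sigma> j)) [0..<n]) g"
    proof (cases "a < b")
      case True
      then show ?thesis using swap.hyps transp[of a b "\<lambda>j. q (\<sigma> j)"] by simp
    next
      case False
      then have "b < a" using swap.hyps by simp
      then show ?thesis using swap.hyps transp[of b a "\<lambda>j. q (\<sigma> j)"]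
        by (simp add: transpose_commute)
    qed
    then show ?case unfolding sgn swap.IH by simp
  qed
qed

lemma foldr_an_not_distinct:
  assumes "\<not> distinct ps"
  shows "foldr an ps f = 0"
proof -
  obtain xs ys zs y where ps: "ps = xs @ [y] @ ys @ [y] @ zs"
    using not_distinct_decomp[OF assms] by blast
  show ?thesis
    unfolding ps append.simps by (rule foldr_an_repeat)
qed

text \<open>Contractions alternate: a repeated letter gives zero, and a permutation gives its sign.
  These are the coordinates of the determinant tensor.\<close>

lemma foldr_an_det:
  fixes f :: "mode set \<Rightarrow> 'a::field"
  assumes "homog n n 0 f" "I \<in> words n n"
  shows "foldr an (map (\<lambda>i. (i, n)) I) (fill n f) = smul (det_tensor n I) f"
proof (cases "distinct I")
  case True
  then obtain \<sigma> where \<sigma>: "\<sigma> permutes {..<n}" "I = map \<sigma> [0..<n]"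
    using assms(2) distinct_word_permutation by blast
  show ?thesis
    unfolding \<sigma>(2) map_map comp_def foldr_an_permutation[OF \<sigma>(1), of "\<lambda>i. (i, n)"]
      foldr_an_fill[OF assms(1)] det_tensor_permutation[OF \<sigma>(1)] ..
next
  case False
  then have "\<not> distinct (map (\<lambda>i. (i, n)) I)" by (auto simp: distinct_map inj_on_def)
  then show ?thesis using False by (simp add: foldr_an_not_distinct not_distinct_tensor)
qed

lemma flat_det_injective:
  fixes f :: "mode set \<Rightarrow> 'a::field_char_0"
  assumes "\<And>j. j < n \<Longrightarrow> homog n j j f" "homog n n 0 f" "flat n (det_tensor n) f = 0"
  shows "f = 0"
proof -
  \<comment> \<open>Contracting the filled slot by \<open>I\<close> leaves the scalar
    \<open>det_tensor n I\<close>, so the sum in \<open>foldr_shift\<close> is the flattening of the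
    determinant tensor.\<close>
  have "(\<Sum>I\<in>words n n. foldr cr (zip I [0..<n]) (foldr an (map (\<lambda>i. (i, n)) I) (fill n f)))
    = flat n (det_tensor n) f"
    unfolding flat_def
    by (intro sum.cong refl) (simp only: foldr_an_det[OF assms(2)] linop_smul[OF linop_foldr_cr])
  then have "foldr (\<lambda>j. shift n j n) [0..<n] (fill n f) = 0"
    by (simp only: foldr_shift assms(3) smul_simps)
  then have "fill n f = 0"
    using assms(1,2) by (intro foldr_shift_injective[OF order.refl homog_fill_other homog_fill]) auto
  moreover have "foldr an (map (\<lambda>i. (i, n)) [0..<n]) (fill n f) = f"
    by (rule foldr_an_fill[OF assms(2)])
  ultimately show ?thesis by (simp add: foldr_an_lin)
qed

section \<open>Exterior multiplication by a fixed vector\<close>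

lemma wedge_wedge:
  "wedge n v j (wedge n w k f) = - wedge n w k (wedge n v j f)"
proof -
  have "wedge n v j (wedge n w k f) = (\<Sum>i<n. \<Sum>l<n. smul (v $ i * w $ l) (cr (i, j) (cr (l, k) f)))"
    for v w :: "'a vec" and j k and f :: "mode set \<Rightarrow> 'a"
    unfolding wedge_def by (simp add: cr_lin smul_sum)
  note * = this
  show ?thesis
    unfolding *
    by (subst sum.swap, subst cr_cr) (simp add: sum_negf mult.commute)
qed

text \<open>Anticommutation gives x = -x, hence x = 0 in characteristic 0.\<close>

lemma wedge_wedge_same: "wedge n v j (wedge n v j f) = 0" for f :: "mode set \<Rightarrow> 'a::field_char_0"
proof
  fix X show "wedge n v j (wedge n v j f) X = 0 X"
    using fun_cong[OF wedge_wedge[of n v j v j f], of X] by (simp add: fun_apply)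
qed

text \<open>The outer wedge moves inward, changing sign at each step, until it meets its own copy.
  Images under the flattening of a pure tensor are therefore killed by the wedge with each of its
  factors.\<close>

lemma wedge_foldr_wedge:
  fixes f :: "mode set \<Rightarrow> 'a::field_char_0"
  assumes "j \<in> set js"
  shows "wedge n (v j) j (foldr (\<lambda>j. wedge n (v j) j) js f) = 0"
  using assms
proof (induction js)
  case (Cons k js)
  show ?case
  proof (cases "j = k")
    case True
    then show ?thesis by (simp add: wedge_wedge_same)
  next
    case False
    then show ?thesis
      using Cons by (simp add: wedge_wedge[of n "v j" j "v k" k] linop_zero[OF linop_wedge])
  qed
qed simp

lemma an_wedge:
  assumes "p < n"
  shows "an (p, k) (wedge n v j f) = (if j = k then smul (v $ p) f else 0) - wedge n v j (an (p, k) f)"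
proof -
  have "an (p, k) (wedge n v j f)
    = (\<Sum>i<n. smul (v $ i) (if (p, k) = (i, j) then f else 0)) - wedge n v j (an (p, k) f)"
    unfolding wedge_def by (simp only: an_lin an_cr smul_diff sum_subtractf)
  moreover have "(\<Sum>i<n. smul (v $ i) (if (p, k) = (i, j) then f else 0))
    = (\<Sum>i<n. if i = p then (if j = k then smul (v $ p) f else 0) else 0)"
    by (intro sum.cong) auto
  ultimately show ?thesis using assms by simp
qed

text \<open>If \<open>v \<and> y = 0\<close> then \<open>v\<^sub>p y = v \<and> (a\<^sub>p y)\<close>, so \<open>y\<close> is determined by its coordinates involving \<open>e\<^sub>p\<close>.\<close>

lemma wedge_kernel_determined:
  fixes y :: "mode set \<Rightarrow> 'a::field"
  assumes "\<And>j. j < m \<Longrightarrow> wedge n (v j) j y = 0"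
    and "\<And>j. j < m \<Longrightarrow> p j < n \<and> v j $ p j \<noteq> 0"
    and "\<And>Y. (\<And>j. j < m \<Longrightarrow> (p j, j) \<in> Y) \<Longrightarrow> y Y = 0"
  shows "y = 0"
  using assms
proof (induction m arbitrary: y)
  case 0
  then show ?case by (auto simp: fun_eq_iff fun_apply)
next
  case (Suc m)
  let ?z = "an (p m, m) y"
  \<comment> \<open>Contraction in slot \<open>m\<close> anticommutes with the wedges in the earlier
    slots, so \<open>?z\<close> is killed by them as well; a coordinate of \<open>?z\<close>
    containing the first \<open>m\<close> pivots is zero or a coordinate of \<open>y\<close>
    containing all \<open>m + 1\<close> of them.\<close>
  have "?z = 0"
  proof (rule Suc.IH)
    fix j assume "j < m"
    then show "wedge n (v j) j ?z = 0"
      using Suc.prems(1)[of j] Suc.prems(2)[of m] an_wedge[of "p m" n m "v j" j y]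
      by (simp add: an_lin)
  next
    fix Y assume Y: "\<And>j. j < m \<Longrightarrow> (p j, j) \<in> Y"
    then have "y (insert (p m, m) Y) = 0" by (intro Suc.prems(3)) (auto simp: less_Suc_eq)
    then show "?z Y = 0" by (simp add: an_def)
  qed (use Suc.prems in auto)
  then have "smul (v m $ p m) y = 0"
    using Suc.prems(1)[of m] Suc.prems(2)[of m] an_wedge[of "p m" n m "v m" m y]
    by (simp add: an_lin linop_zero[OF linop_wedge])
  then show ?case using Suc.prems(2)[of m] by (auto simp: smul_def fun_eq_iff fun_apply)
qed

section \<open>Dimension count\<close>

definition slot :: "mode set \<Rightarrow> nat \<Rightarrow> nat set" where
  "slot X j = {i. (i, j) \<in> X}"

definition states :: "nat \<Rightarrow> (nat \<Rightarrow> nat set set) \<Rightarrow> mode set set" where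
  "states n \<S> = {X. X \<subseteq> {..<n} \<times> {..<n} \<and> (\<forall>j<n. slot X j \<in> \<S> j)}"

lemma finite_states: "finite (states n \<S>)"
  by (rule finite_subset[of _ "Pow ({..<n} \<times> {..<n})"]) (auto simp: states_def)

lemma card_states:
  assumes "\<And>j. j < n \<Longrightarrow> \<S> j \<subseteq> Pow {..<n}"
  shows "card (states n \<S>) = (\<Prod>j<n. card (\<S> j))"
proof -
  have "bij_betw (\<lambda>X. \<lambda>j\<in>{..<n}. slot X j) (states n \<S>) (PiE {..<n} \<S>)"
  proof (rule bij_betw_byWitness[where f' = "\<lambda>g. {(i, j). j < n \<and> i \<in> g j}"])
    show "\<forall>X\<in>states n \<S>. {(i, j). j < n \<and> i \<in> (\<lambda>j\<in>{..<n}. slot X j) j} = X"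
      by (auto simp: states_def slot_def)
    show "\<forall>g\<in>PiE {..<n} \<S>. (\<lambda>j\<in>{..<n}. slot {(i, j). j < n \<and> i \<in> g j} j) = g"
      by (auto simp: slot_def PiE_def extensional_def fun_eq_iff)
    show "(\<lambda>X. \<lambda>j\<in>{..<n}. slot X j) ` states n \<S> \<subseteq> PiE {..<n} \<S>"
      by (auto simp: states_def)
    show "(\<lambda>g. {(i, j). j < n \<and> i \<in> g j}) ` PiE {..<n} \<S> \<subseteq> states n \<S>"
    proof safe
      fix g assume g: "g \<in> PiE {..<n} \<S>"
      then have "slot {(i, j). j < n \<and> i \<in> g j} j \<in> \<S> j" if "j < n" for j
        using that by (auto simp: slot_def)
      moreover have "g j \<subseteq> {..<n}" if "j < n" for j
        using g that assms[OF that] by (auto simp: PiE_iff)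
      ultimately show "{(i, j). j < n \<and> i \<in> g j} \<in> states n \<S>"
        unfolding states_def by blast
    qed
  qed
  then have "card (states n \<S>) = card (PiE {..<n} \<S>)" by (rule bij_betw_same_card)
  then show ?thesis by (simp add: card_PiE)
qed

definition layer :: "nat \<Rightarrow> nat \<Rightarrow> nat set set" where
  "layer n d = {S. S \<subseteq> {..<n} \<and> card S = d}"

definition pivot_layer :: "nat \<Rightarrow> nat \<Rightarrow> nat \<Rightarrow> nat set set" where
  "pivot_layer n p d = {S. S \<subseteq> {..<n} \<and> p \<in> S \<and> card S = d}"

lemma card_layer: "card (layer n d) = n choose d"
  using n_subsets[of "{..<n}" d] by (simp add: layer_def)

lemma card_pivot_layer:
  assumes "p < n"
  shows "card (pivot_layer n p (Suc d)) = (n - 1) choose d"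
proof -
  have fin: "finite S" if "S \<subseteq> {..<n}" for S using that finite_subset by blast
  have "bij_betw (insert p) {S. S \<subseteq> {..<n} - {p} \<and> card S = d} (pivot_layer n p (Suc d))"
  proof (rule bij_betw_byWitness[where f' = "\<lambda>S. S - {p}"])
    show "insert p ` {S. S \<subseteq> {..<n} - {p} \<and> card S = d} \<subseteq> pivot_layer n p (Suc d)"
      using assms fin by (auto simp: pivot_layer_def card_insert_if subset_Diff_insert)
    show "(\<lambda>S. S - {p}) ` pivot_layer n p (Suc d) \<subseteq> {S. S \<subseteq> {..<n} - {p} \<and> card S = d}"
      using fin by (auto simp: pivot_layer_def)
  qed (auto simp: pivot_layer_def)
  then have "card (pivot_layer n p (Suc d)) = card {S. S \<subseteq> {..<n} - {p} \<and> card S = d}"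
    by (rule bij_betw_same_card[symmetric])
  also have "\<dots> = (n - 1) choose d"
    using n_subsets[of "{..<n} - {p}" d] assms by simp
  finally show ?thesis .
qed

text \<open>\<open>source\<close> and \<open>target\<close> index the monomial bases of the domain
  and codomain of the flattening: slot \<open>j\<close> holds \<open>j\<close> vectors before and
  \<open>j + 1\<close> after.\<close>

definition source :: "nat \<Rightarrow> mode set set" where
  "source n = states n (layer n)"

definition target :: "nat \<Rightarrow> mode set set" where
  "target n = states n (\<lambda>j. layer n (Suc j))"

lemma card_source: "card (source n) = (\<Prod>j<n. n choose j)"
  unfolding source_def by (subst card_states) (auto simp: layer_def card_layer[unfolded layer_def])

lemma card_target: "card (target n) = card (source n)"
proof -
  have "card (target n) = (\<Prod>j<n. n choose Suc j)"
    unfolding target_def by (subst card_states) (auto simp: layer_def card_layer[unfolded layer_def])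
  also have "\<dots> = (\<Prod>j<n. n choose j)"
  proof (cases n)
    case (Suc m)
    \<comment> \<open>Both sides are the product over all \<open>j\<close> from 0 to
      \<open>n\<close>; the two end factors are 1, so shifting the index changes nothing.\<close>
    have "(\<Prod>j<n. n choose j) * (n choose n) = (n choose 0) * (\<Prod>j<n. n choose Suc j)"
      by (metis prod.lessThan_Suc prod.lessThan_Suc_shift)
    then show ?thesis by simp
  qed simp
  finally show ?thesis by (simp add: card_source)
qed

lemma occ_slot: "X \<subseteq> {..<n} \<times> UNIV \<Longrightarrow> occ n j X = card (slot X j)"
  unfolding occ_def slot_def by (intro arg_cong[where f = card]) auto

lemma homog_source:
  assumes "\<And>X. X \<notin> source n \<Longrightarrow> f X = 0"
  shows "j < n \<Longrightarrow> homog n j j f" "homog n n 0 f"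
proof -
  have X: "X \<in> source n" if "f X \<noteq> 0" for X using assms that by blast
  show "homog n j j f" if "j < n"
    unfolding homog_def
  proof (intro allI impI)
    fix X assume "f X \<noteq> 0"
    then have X: "X \<subseteq> {..<n} \<times> {..<n}" "card (slot X j) = j"
      using X[of X] that by (auto simp: source_def states_def layer_def)
    then have "X \<subseteq> {..<n} \<times> UNIV" by auto
    then show "occ n j X = j" using X(2) by (simp add: occ_slot)
  qed
  show "homog n n 0 f"
    unfolding homog_def
  proof (intro allI impI)
    fix X assume "f X \<noteq> 0"
    then have "{i. i < n \<and> (i, n) \<in> X} = {}" using X[of X] by (auto simp: source_def states_def)
    then show "occ n n X = 0" by (simp add: occ_def)
  qed
qed

text \<open>A word creates exactly one mode per slot, and a nonzero coefficient forces it to be new,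
  so a slot of size \<open>j\<close> grows to size \<open>j + 1\<close>.\<close>

lemma flat_target:
  assumes f: "\<And>X. X \<notin> source n \<Longrightarrow> f X = 0" and Y: "Y \<notin> target n"
  shows "flat n T f Y = 0"
proof (rule ccontr)
  assume "flat n T f Y \<noteq> 0"
  then have "(\<Sum>I\<in>words n n. T I * foldr cr (zip I [0..<n]) f Y) \<noteq> 0"
    by (simp add: flat_def sum_fun_apply smul_def)
  then obtain I where I: "I \<in> words n n" "T I * foldr cr (zip I [0..<n]) f Y \<noteq> 0"
    by (rule sum.not_neutral_contains_not_neutral)
  then have I2: "foldr cr (zip I [0..<n]) f Y \<noteq> 0" by auto
  let ?Z = "set (zip I [0..<n])"
  have Z: "?Z \<subseteq> Y" and X: "Y - ?Z \<in> source n"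
    using foldr_cr_nonzero[OF I2] f by blast+
  have l: "length I = n" "\<And>j. j < n \<Longrightarrow> I ! j < n"
    using I(1) by (auto simp: words_def subset_iff in_set_conv_nth)
  have Z_eq: "?Z = (\<lambda>j. (I ! j, j)) ` {..<n}"
    using l by (auto simp: set_zip image_def)
  have "slot Y j \<in> layer n (Suc j)" if j: "j < n" for j
  proof -
    have "slot Y j = insert (I ! j) (slot (Y - ?Z) j)"
      using Z j unfolding Z_eq slot_def by auto
    moreover have "I ! j \<notin> slot (Y - ?Z) j" using j unfolding Z_eq slot_def by auto
    moreover have "slot (Y - ?Z) j \<in> layer n j" using X j by (simp add: source_def states_def)
    moreover from this have "finite (slot (Y - ?Z) j)"
      unfolding layer_def using finite_subset by blast
    ultimately show ?thesis using l(2)[OF j] by (simp add: layer_def)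
  qed
  moreover have "Y \<subseteq> {..<n} \<times> {..<n}"
  proof -
    have "Y - ?Z \<subseteq> {..<n} \<times> {..<n}" using X by (simp add: source_def states_def)
    moreover have "?Z \<subseteq> {..<n} \<times> {..<n}" using l unfolding Z_eq by auto
    ultimately show ?thesis by blast
  qed
  ultimately show False using Y by (simp add: target_def states_def)
qed

section \<open>Kernels of flattenings of tensors of small rank\<close>

lemma underdetermined_system:
  fixes L :: "'r \<Rightarrow> 'b \<Rightarrow> 'a::field"
  assumes "finite R" "finite B" "card R < card B"
  shows "\<exists>f. (\<exists>b\<in>B. f b \<noteq> 0) \<and> (\<forall>r\<in>R. (\<Sum>b\<in>B. L r b * f b) = 0)"
  using assms
proof (induction R arbitrary: B L rule: finite_induct)
  case empty
  then obtain b where "b \<in> B" by fastforce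
  then show ?case by (intro exI[of _ "\<lambda>_. 1"]) auto
next
  case (insert r R)
  show ?case
  proof (cases "\<forall>b\<in>B. L r b = 0")
    case True
    have "card R < card B" using insert by simp
    from insert.IH[OF insert.prems(1) this] show ?thesis using True by auto
  next
    case False
    then obtain b0 where b0: "b0 \<in> B" "L r b0 \<noteq> 0" by blast
    \<comment> \<open>Gaussian elimination: equation \<open>r\<close> is used to remove the unknown
      \<open>b0\<close> from the others, and \<open>g\<close> below recovers \<open>b0\<close> by
      back substitution.\<close>
    define L' where "L' s b = L s b - L s b0 * (L r b / L r b0)" for s b
    have "card R < card (B - {b0})" using insert b0 by simp
    then obtain f where f: "\<exists>b\<in>B - {b0}. f b \<noteq> 0" "\<And>s. s \<in> R \<Longrightarrow> (\<Sum>b\<in>B - {b0}. L' s b * f b) = 0"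
      using insert.IH[of "B - {b0}" L'] insert.prems(1) by blast
    define g where "g = f(b0 := - (\<Sum>b\<in>B - {b0}. L r b * f b) / L r b0)"
    have split: "(\<Sum>b\<in>B. L s b * g b) = L s b0 * g b0 + (\<Sum>b\<in>B - {b0}. L s b * f b)" for s
      using insert.prems(1) b0(1) by (simp add: sum.remove g_def cong: sum.cong_simp)
    have "(\<Sum>b\<in>B. L s b * g b) = 0" if "s \<in> R" for s
    proof -
      have "(\<Sum>b\<in>B - {b0}. L' s b * f b)
        = (\<Sum>b\<in>B - {b0}. L s b * f b) - L s b0 / L r b0 * (\<Sum>b\<in>B - {b0}. L r b * f b)"
        by (simp add: L'_def sum_subtractf sum_distrib_left algebra_simps)
      then show ?thesis unfolding split using f(2)[OF that] by (simp add: g_def)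
    qed
    moreover have "(\<Sum>b\<in>B. L r b * g b) = 0" unfolding split using b0 by (simp add: g_def)
    moreover have "\<exists>b\<in>B. g b \<noteq> 0" using f(1) by (auto simp: g_def)
    ultimately show ?thesis by blast
  qed
qed

definition delta :: "'b \<Rightarrow> 'b \<Rightarrow> 'a::zero_neq_one" where
  "delta X = (\<lambda>Y. if Y = X then 1 else 0)"

lemma linop_flat: "linop (flat n T)"
  unfolding flat_def by (intro linop_sumI linop_smulI linop_foldr_cr)

lemma delta_expansion:
  fixes f :: "'b \<Rightarrow> 'a::comm_ring_1"
  assumes "finite B" "\<And>X. X \<notin> B \<Longrightarrow> f X = 0"
  shows "f = (\<Sum>X\<in>B. smul (f X) (delta X))"
  using assms by (auto simp: fun_eq_iff sum_fun_apply smul_def delta_def if_distrib sum.delta' cong: if_cong)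

lemma flat_delta_expansion:
  assumes "\<And>X. X \<notin> source n \<Longrightarrow> f X = 0"
  shows "flat n T f Y = (\<Sum>X\<in>source n. flat n T (delta X) Y * f X)"
proof -
  have fin: "finite (source n)" by (simp add: source_def finite_states)
  have "flat n T f = flat n T (\<Sum>X\<in>source n. smul (f X) (delta X))"
    using delta_expansion[OF fin, of f] assms by simp
  also have "\<dots> = (\<Sum>X\<in>source n. smul (f X) (flat n T (delta X)))"
    by (simp only: linop_sum[OF linop_flat] linop_smul[OF linop_flat])
  finally show ?thesis by (simp add: sum_fun_apply smul_def mult.commute)
qed

lemma flat_sum: "flat n (\<lambda>I. \<Sum>i\<in>A. T i I) f = (\<Sum>i\<in>A. flat n (T i) f)"
proof -
  have "smul (\<Sum>i\<in>A. T i I) g = (\<Sum>i\<in>A. smul (T i I) g)" for I and g :: "mode set \<Rightarrow> 'a"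
    by (auto simp: smul_def fun_eq_iff sum_fun_apply sum_distrib_right)
  then show ?thesis unfolding flat_def by (simp add: sum.swap[of _ A])
qed

text \<open>The rank bound for a pure tensor, phrased as a small set \<open>R\<close> of coordinates
  that detects vanishing of the image. With a nonzero entry \<open>p j\<close> chosen in every
  factor, \<open>R\<close> consists of the target monomials containing all pivots; if some factor is
  zero, so is the tensor, and \<open>R\<close> is empty.\<close>

lemma flat_pure_tensor_determined:
  fixes vs :: "'a::field_char_0 vec list"
  assumes vs: "map dim_vec vs = replicate n n"
  shows "\<exists>R. finite R \<and> card R \<le> (\<Prod>j<n. (n - 1) choose j) \<and>
    (\<forall>f. (\<forall>X. X \<notin> source n \<longrightarrow> f X = 0) \<longrightarrow> (\<forall>Y\<in>R. flat n (pure_tensor vs) f Y = 0) \<longrightarrow>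
      flat n (pure_tensor vs) f = 0)"
proof (cases "\<forall>j<n. \<exists>p<n. vs ! j $ p \<noteq> 0")
  case True
  then obtain p where p: "\<And>j. j < n \<Longrightarrow> p j < n \<and> vs ! j $ p j \<noteq> 0" by metis
  define R where "R = states n (\<lambda>j. pivot_layer n (p j) (Suc j))"
  have "card R = (\<Prod>j<n. (n - 1) choose j)"
    unfolding R_def using p
    by (subst card_states) (auto simp: pivot_layer_def card_pivot_layer[unfolded pivot_layer_def])
  moreover have "flat n (pure_tensor vs) f = 0"
    if f: "\<forall>X. X \<notin> source n \<longrightarrow> f X = 0" and R: "\<forall>Y\<in>R. flat n (pure_tensor vs) f Y = 0" for f
  proof (rule wedge_kernel_determined[where v = "\<lambda>j. vs ! j" and p = p and m = n])
    show "wedge n (vs ! j) j (flat n (pure_tensor vs) f) = 0" if "j < n" for j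
      unfolding flat_pure_tensor[OF vs] using that
      by (intro wedge_foldr_wedge[where v = "\<lambda>j. vs ! j"]) simp
    show "flat n (pure_tensor vs) f Y = 0" if Y: "\<And>j. j < n \<Longrightarrow> (p j, j) \<in> Y" for Y
    proof (cases "Y \<in> target n")
      case True
      then have "Y \<in> R"
        using Y by (auto simp: R_def target_def states_def layer_def pivot_layer_def slot_def)
      then show ?thesis using R by blast
    next
      case False
      then show ?thesis using f by (intro flat_target) auto
    qed
  qed (use p in auto)
  moreover have "finite R" by (simp add: R_def finite_states)
  ultimately show ?thesis by (intro exI[of _ R]) auto
next
  case False
  then obtain j where j: "j < n" "\<And>p. p < n \<Longrightarrow> vs ! j $ p = 0" by blast
  have n: "length vs = n" using vs by (metis length_map length_replicate)
  have "pure_tensor vs I = 0" if "I \<in> words n n" for I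
  proof -
    have "I ! j < n" using that j by (auto simp: words_def subset_iff)
    then have "(\<Prod>j<length vs. vs ! j $ (I ! j)) = 0"
      using j by (intro prod_zero bexI[of _ j]) (auto simp: n)
    then show ?thesis by (simp add: pure_tensor_def)
  qed
  then have "flat n (pure_tensor vs) f = 0" for f
    unfolding flat_def by (intro sum.neutral) auto
  then show ?thesis by (intro exI[of _ "{}"]) auto
qed

text \<open>Each summand vanishes on \<open>f\<close> once its detecting coordinates do. This is a
  homogeneous linear system with fewer equations than unknowns.\<close>

lemma flat_kernel:
  fixes T :: "'a::field_char_0 tensor"
  assumes T: "is_sum_of_pure_tensors (replicate n n) k T"
    and k: "k * (\<Prod>j<n. (n - 1) choose j) < card (source n)"
  shows "\<exists>f. f \<noteq> 0 \<and> (\<forall>X. X \<notin> source n \<longrightarrow> f X = 0) \<and> flat n T f = 0"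
proof -
  obtain v where v: "\<And>i. i < k \<Longrightarrow> map dim_vec (v i) = replicate n n"
    and T_eq: "T = (\<lambda>I. \<Sum>i<k. pure_tensor (v i) I)"
    using T unfolding is_sum_of_pure_tensors_def by blast
  define P where "P i R \<longleftrightarrow> finite R \<and> card R \<le> (\<Prod>j<n. (n - 1) choose j) \<and>
    (\<forall>f. (\<forall>X. X \<notin> source n \<longrightarrow> f X = 0) \<longrightarrow> (\<forall>Y\<in>R. flat n (pure_tensor (v i)) f Y = 0) \<longrightarrow>
      flat n (pure_tensor (v i)) f = 0)" for i and R :: "mode set set"
  have "\<forall>i\<in>{..<k}. \<exists>R. P i R"
    unfolding P_def by (intro ballI flat_pure_tensor_determined v) simp
  from bchoice[OF this] obtain R where PR: "\<And>i. i < k \<Longrightarrow> P i (R i)" by auto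
  have R: "\<And>i. i < k \<Longrightarrow> finite (R i)"
    "\<And>i. i < k \<Longrightarrow> card (R i) \<le> (\<Prod>j<n. (n - 1) choose j)"
    "\<And>i f. i < k \<Longrightarrow> (\<forall>X. X \<notin> source n \<longrightarrow> f X = 0) \<Longrightarrow>
      (\<forall>Y\<in>R i. flat n (pure_tensor (v i)) f Y = 0) \<Longrightarrow> flat n (pure_tensor (v i)) f = 0"
    using PR unfolding P_def by meson+
  \<comment> \<open>One equation for each pair of a summand and one of its detecting
    coordinates.\<close>
  have "card (Sigma {..<k} R) = (\<Sum>i<k. card (R i))" using R(1) by (simp add: card_SigmaI)
  also have "\<dots> \<le> (\<Sum>i<k. \<Prod>j<n. (n - 1) choose j)" by (intro sum_mono R(2)) simp
  also have "\<dots> < card (source n)" using k by simp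
  finally have "card (Sigma {..<k} R) < card (source n)" .
  moreover have "finite (Sigma {..<k} R)" "finite (source n)"
    using R(1) by (auto simp: source_def finite_states)
  ultimately obtain g where g: "\<exists>X\<in>source n. g X \<noteq> 0"
    "\<forall>r\<in>Sigma {..<k} R. (\<Sum>X\<in>source n. (case r of (i, Y) \<Rightarrow> flat n (pure_tensor (v i)) (delta X) Y) * g X) = 0"
    using underdetermined_system[of "Sigma {..<k} R" "source n"
        "\<lambda>r X. case r of (i, Y) \<Rightarrow> flat n (pure_tensor (v i)) (delta X) Y"] by blast
  define f where "f X = (if X \<in> source n then g X else 0)" for X
  have supp: "\<forall>X. X \<notin> source n \<longrightarrow> f X = 0" by (simp add: f_def)
  have "flat n (pure_tensor (v i)) f = 0" if i: "i < k" for i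
  proof (rule R(3)[OF i supp], intro ballI)
    fix Y assume "Y \<in> R i"
    then have "(\<Sum>X\<in>source n. flat n (pure_tensor (v i)) (delta X) Y * g X) = 0"
      using g(2) i by auto
    moreover have "flat n (pure_tensor (v i)) f Y = (\<Sum>X\<in>source n. flat n (pure_tensor (v i)) (delta X) Y * f X)"
      using supp by (intro flat_delta_expansion) blast
    ultimately show "flat n (pure_tensor (v i)) f Y = 0" by (simp add: f_def)
  qed
  then have "flat n T f = 0" unfolding T_eq flat_sum by simp
  moreover have "f \<noteq> 0" using g(1) by (auto simp: f_def fun_eq_iff fun_apply)
  ultimately show ?thesis using supp by blast
qed

section \<open>Border rank of the determinant tensor\<close>

text \<open>Translates singularity of the matrix into the existence of a nonzero solution on
  \<open>B\<close>, so that the column numbering \<open>h\<close> disappears from later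
  arguments.\<close>

lemma det_mat_eq_0_iff:
  fixes L :: "nat \<Rightarrow> 'b \<Rightarrow> 'a::field"
  assumes h: "bij_betw h {..<N} B"
  shows "det (mat N N (\<lambda>(r, s). L r (h s))) = 0 \<longleftrightarrow>
    (\<exists>f. (\<exists>b\<in>B. f b \<noteq> 0) \<and> (\<forall>r<N. (\<Sum>b\<in>B. L r b * f b) = 0))"
    (is "det ?A = 0 \<longleftrightarrow> ?R")
proof -
  have A: "?A \<in> carrier_mat N N" by simp
  have mult: "(?A *\<^sub>v vec N (\<lambda>s. f (h s))) $ r = (\<Sum>b\<in>B. L r b * f b)" if "r < N" for f r
  proof -
    have "(?A *\<^sub>v vec N (\<lambda>s. f (h s))) $ r = (\<Sum>s<N. L r (h s) * f (h s))"
      using that by (simp add: scalar_prod_def atLeast0LessThan)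
    also have "\<dots> = (\<Sum>b\<in>B. L r b * f b)" by (rule sum.reindex_bij_betw[OF h])
    finally show ?thesis .
  qed
  have "?R \<longleftrightarrow> (\<exists>v. v \<in> carrier_vec N \<and> v \<noteq> 0\<^sub>v N \<and> ?A *\<^sub>v v = 0\<^sub>v N)"
  proof
    assume ?R
    then obtain f b where f: "b \<in> B" "f b \<noteq> 0" "\<And>r. r < N \<Longrightarrow> (\<Sum>b\<in>B. L r b * f b) = 0" by blast
    obtain s where s: "s < N" "b = h s" using f(1) h by (auto simp: bij_betw_def)
    let ?v = "vec N (\<lambda>s. f (h s))"
    have "?v $ s \<noteq> 0" using s f(2) by simp
    then have "?v \<noteq> 0\<^sub>v N" using s(1) index_zero_vec(1) by metis
    moreover have "?A *\<^sub>v ?v = 0\<^sub>v N"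
    proof (rule eq_vecI)
      fix r assume "r < dim_vec (0\<^sub>v N :: 'a vec)"
      then show "(?A *\<^sub>v ?v) $ r = 0\<^sub>v N $ r" using mult[of r f] f(3)[of r] by simp
    qed simp
    ultimately show "\<exists>v. v \<in> carrier_vec N \<and> v \<noteq> 0\<^sub>v N \<and> ?A *\<^sub>v v = 0\<^sub>v N"
      by (intro exI[of _ ?v]) auto
  next
    assume "\<exists>v. v \<in> carrier_vec N \<and> v \<noteq> 0\<^sub>v N \<and> ?A *\<^sub>v v = 0\<^sub>v N"
    then obtain v where v: "v \<in> carrier_vec N" "v \<noteq> 0\<^sub>v N" "?A *\<^sub>v v = 0\<^sub>v N" by blast
    define f where "f b = v $ inv_into {..<N} h b" for b
    have fh: "f (h s) = v $ s" if "s < N" for s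
      using that h by (simp add: f_def bij_betw_def inv_into_f_f)
    have v_eq: "v = vec N (\<lambda>s. f (h s))" using v(1) fh by (intro eq_vecI) auto
    obtain s where s: "s < N" "v $ s \<noteq> 0"
      using v(1,2) by (metis carrier_vecD eq_vecI index_zero_vec(1) index_zero_vec(2))
    have "h s \<in> B" using s(1) h by (auto simp: bij_betw_def)
    moreover have "f (h s) \<noteq> 0" using s fh by simp
    moreover have "(\<Sum>b\<in>B. L r b * f b) = 0" if "r < N" for r
      using mult[OF that, of f] v(3) that unfolding v_eq[symmetric] by simp
    ultimately show ?R by blast
  qed
  then show ?thesis using det_0_iff_vec_prod_zero_field[OF A] by simp
qed

section \<open>Polynomial functions of a tensor\<close>

lemma polynomial_functions_sum:
  "(\<And>a. a \<in> A \<Longrightarrow> p a \<in> polynomial_functions ms) \<Longrightarrow> (\<lambda>T. \<Sum>a\<in>A. p a T) \<in> polynomial_functions ms"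
  by (induction A rule: infinite_finite_induct) (simp_all add: polynomial_functions.const polynomial_functions.add)

lemma polynomial_functions_prod:
  "(\<And>a. a \<in> A \<Longrightarrow> p a \<in> polynomial_functions ms) \<Longrightarrow> (\<lambda>T. \<Prod>a\<in>A. p a T) \<in> polynomial_functions ms"
  by (induction A rule: infinite_finite_induct) (simp_all add: polynomial_functions.const polynomial_functions.mult)

lemma polynomial_functions_flat:
  "(\<lambda>T. flat n T g Y) \<in> polynomial_functions (replicate n n)"
  unfolding flat_def sum_fun_apply smul_def
  by (intro polynomial_functions_sum polynomial_functions.mult polynomial_functions.const
      polynomial_functions.coord) (simp add: multi_indices_replicate)

lemma polynomial_functions_det:
  assumes "\<And>r s. r < N \<Longrightarrow> s < N \<Longrightarrow> (\<lambda>T. p T r s) \<in> polynomial_functions ms"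
  shows "(\<lambda>T. det (mat N N (\<lambda>(r, s). p T r s))) \<in> polynomial_functions ms"
proof -
  have "(\<lambda>T. \<Sum>\<pi> | \<pi> permutes {0..<N}. of_int (sign \<pi>) * (\<Prod>i = 0..<N. p T i (\<pi> i))) \<in> polynomial_functions ms"
    using assms
    by (intro polynomial_functions_sum polynomial_functions.mult polynomial_functions.const
        polynomial_functions_prod) (auto dest: permutes_in_image)
  also have "(\<lambda>T. \<Sum>\<pi> | \<pi> permutes {0..<N}. of_int (sign \<pi>) * (\<Prod>i = 0..<N. p T i (\<pi> i)))
    = (\<lambda>T. det (mat N N (\<lambda>(r, s). p T r s)))"
  proof
    fix T
    show "(\<Sum>\<pi> | \<pi> permutes {0..<N}. of_int (sign \<pi>) * (\<Prod>i = 0..<N. p T i (\<pi> i)))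
      = det (mat N N (\<lambda>(r, s). p T r s))"
      by (subst det_def'[of _ N]) (auto intro!: sum.cong prod.cong dest: permutes_in_image)
  qed
  finally show ?thesis .
qed

text \<open>The polynomial is the determinant of the flattening in the monomial bases, a square
  matrix by \<open>card_target\<close>. Its zeros are described by kernels, so the chosen numberings
  do not matter.\<close>

lemma flat_singular_polynomial:
  "\<exists>p :: 'a::field_char_0 tensor \<Rightarrow> 'a. p \<in> polynomial_functions (replicate n n) \<and>
    (\<forall>T. p T = 0 \<longleftrightarrow> (\<exists>f. f \<noteq> 0 \<and> (\<forall>X. X \<notin> source n \<longrightarrow> f X = 0) \<and> flat n T f = 0))"
proof -
  define N where "N = card (source n)"
  have fin: "finite (source n)" "finite (target n)"
    by (auto simp: source_def target_def finite_states)
  obtain h where h: "bij_betw h {..<N} (source n)"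
    using ex_bij_betw_nat_finite[OF fin(1)] by (auto simp: N_def atLeast0LessThan)
  obtain h' where h': "bij_betw h' {..<N} (target n)"
    using ex_bij_betw_nat_finite[OF fin(2)] by (auto simp: N_def card_target atLeast0LessThan)
  define p :: "'a tensor \<Rightarrow> 'a" where
    "p T = det (mat N N (\<lambda>(r, s). flat n T (delta (h s)) (h' r)))" for T
  have "p \<in> polynomial_functions (replicate n n)"
    unfolding p_def by (intro polynomial_functions_det polynomial_functions_flat)
  moreover have "p T = 0 \<longleftrightarrow> (\<exists>f. f \<noteq> 0 \<and> (\<forall>X. X \<notin> source n \<longrightarrow> f X = 0) \<and> flat n T f = 0)" for T
  proof -
    have p0: "p T = 0 \<longleftrightarrow> (\<exists>f. (\<exists>X\<in>source n. f X \<noteq> 0) \<and>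
        (\<forall>r<N. (\<Sum>X\<in>source n. flat n T (delta X) (h' r) * f X) = 0))"
      unfolding p_def by (rule det_mat_eq_0_iff[OF h, of "\<lambda>r X. flat n T (delta X) (h' r)"])
    show ?thesis
    proof
      assume "p T = 0"
      then obtain g where g: "\<exists>X\<in>source n. g X \<noteq> 0"
        "\<And>r. r < N \<Longrightarrow> (\<Sum>X\<in>source n. flat n T (delta X) (h' r) * g X) = 0"
        unfolding p0 by blast
      define f where "f X = (if X \<in> source n then g X else 0)" for X
      have supp: "\<And>X. X \<notin> source n \<Longrightarrow> f X = 0" by (simp add: f_def)
      have "flat n T f Y = 0" for Y
      proof (cases "Y \<in> target n")
        case True
        then obtain r where r: "r < N" "Y = h' r" using h' by (auto simp: bij_betw_def)
        have "flat n T f Y = (\<Sum>X\<in>source n. flat n T (delta X) Y * f X)"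
          by (intro flat_delta_expansion supp)
        then show ?thesis using g(2)[OF r(1)] by (simp add: f_def r(2))
      next
        case False
        then show ?thesis by (intro flat_target supp)
      qed
      then have "flat n T f = 0" by (simp add: fun_eq_iff fun_apply)
      moreover have "f \<noteq> 0" using g(1) by (auto simp: f_def fun_eq_iff fun_apply)
      ultimately show "\<exists>f. f \<noteq> 0 \<and> (\<forall>X. X \<notin> source n \<longrightarrow> f X = 0) \<and> flat n T f = 0"
        using supp by blast
    next
      assume "\<exists>f. f \<noteq> 0 \<and> (\<forall>X. X \<notin> source n \<longrightarrow> f X = 0) \<and> flat n T f = 0"
      then obtain f where f: "f \<noteq> 0" "\<And>X. X \<notin> source n \<Longrightarrow> f X = 0" "flat n T f = 0" by blast
      then have "(\<Sum>X\<in>source n. flat n T (delta X) Y * f X) = 0" for Y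
        using flat_delta_expansion[of n f T Y] by (simp add: fun_apply)
      moreover have "\<exists>X\<in>source n. f X \<noteq> 0"
      proof (rule ccontr)
        assume "\<not> (\<exists>X\<in>source n. f X \<noteq> 0)"
        then have "f X = 0" for X using f(2) by blast
        then show False using f(1) by (simp add: fun_eq_iff fun_apply)
      qed
      ultimately show "p T = 0" unfolding p0 by blast
    qed
  qed
  ultimately show ?thesis by (intro exI[of _ p]) simp
qed

section \<open>Border rank and the flattening bound\<close>

lemma border_rank_attained:
  assumes "T \<in> tensor_space ms"
  shows "T \<in> zariski_closure ms {S \<in> tensor_space ms. tensor_rank ms S \<le> border_rank ms T}"
  unfolding border_rank_def
proof (rule LeastI)
  \<comment> \<open>The tensor rank of \<open>T\<close> witnesses that the minimum ranges over a
    nonempty set.\<close>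
  show "T \<in> zariski_closure ms {S \<in> tensor_space ms. tensor_rank ms S \<le> tensor_rank ms T}"
    by (rule subsetD[OF zariski_closure_superset]) (use assms in simp)
qed

lemma border_rank_le_tensor_rank:
  assumes "T \<in> tensor_space ms"
  shows "border_rank ms T \<le> tensor_rank ms T"
  unfolding border_rank_def
proof (rule Least_le)
  show "T \<in> zariski_closure ms {S \<in> tensor_space ms. tensor_rank ms S \<le> tensor_rank ms T}"
    by (rule subsetD[OF zariski_closure_superset]) (use assms in simp)
qed

text \<open>If the bound failed, the flattening determinant would vanish on all tensors of rank at
  most the border rank, hence on their closure and at the determinant tensor, against
  \<open>flat_det_injective\<close>.\<close>

lemma border_rank_det_flattening:
  assumes "n \<ge> 1"
  shows "(\<Prod>j<n. n choose j) \<le>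
    border_rank (replicate n n) (det_tensor n :: 'a::field_char_0 tensor) * (\<Prod>j<n. (n - 1) choose j)"
proof (rule ccontr)
  let ?ms = "replicate n n" and ?k = "border_rank (replicate n n) (det_tensor n :: 'a tensor)"
  let ?r = "\<Prod>j<n. (n - 1) choose j"
  assume "\<not> ?thesis"
  then have less: "?k * ?r < card (source n)" by (simp add: card_source)
  obtain p :: "'a tensor \<Rightarrow> 'a" where p: "p \<in> polynomial_functions ?ms"
    "\<And>T. p T = 0 \<longleftrightarrow> (\<exists>f. f \<noteq> 0 \<and> (\<forall>X. X \<notin> source n \<longrightarrow> f X = 0) \<and> flat n T f = 0)"
    using flat_singular_polynomial[of n, where 'a = 'a] by (elim exE conjE) simp
  let ?Z = "{T \<in> tensor_space ?ms. \<forall>q\<in>{p}. q T = 0}"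
  have "zariski_closed ?ms ?Z"
    unfolding zariski_closed_def using p(1) by (intro exI[of _ "{p}"]) auto
  moreover have "{S \<in> tensor_space ?ms. tensor_rank ?ms S \<le> ?k} \<subseteq> ?Z"
  proof
    fix S :: "'a tensor" assume S: "S \<in> {S \<in> tensor_space ?ms. tensor_rank ?ms S \<le> ?k}"
    have "\<exists>k. is_sum_of_pure_tensors ?ms k S"
      using S assms by (intro is_sum_of_pure_tensors_ex) auto
    \<comment> \<open>Since \<open>n \<ge> 1\<close>, the format is nonempty and a decomposition
      exists, so \<open>LEAST\<close> is attained.\<close>
    then have "is_sum_of_pure_tensors ?ms (tensor_rank ?ms S) S"
      unfolding tensor_rank_def by (rule LeastI_ex)
    moreover have "tensor_rank ?ms S * ?r < card (source n)"
      using S less by (intro le_less_trans[OF mult_le_mono1 less]) simp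
    ultimately have "p S = 0" unfolding p(2) by (rule flat_kernel)
    then show "S \<in> ?Z" using S by simp
  qed
  ultimately have "det_tensor n \<in> ?Z"
    using border_rank_attained[OF det_tensor_in_tensor_space[of n, where 'a = 'a]]
    unfolding zariski_closure_def by blast
  then have "p (det_tensor n) = 0" by simp
  then have "\<exists>f. f \<noteq> 0 \<and> (\<forall>X. X \<notin> source n \<longrightarrow> f X = 0) \<and> flat n (det_tensor n :: 'a tensor) f = 0"
    by (rule p(2)[THEN iffD1])
  then obtain f :: "mode set \<Rightarrow> 'a" where f: "f \<noteq> 0" "\<And>X. X \<notin> source n \<Longrightarrow> f X = 0"
    "flat n (det_tensor n) f = 0" by (elim exE conjE) simp
  have "f = 0"
    by (rule flat_det_injective[OF homog_source(1)[OF f(2)] homog_source(2)[OF f(2)] f(3)])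
  then show False using f(1) by simp
qed

text \<open>Distributing the factors \<open>n - j\<close> of \<open>n!\<close> reduces the claim to
  \<open>(n - j) * (n choose j) = n * ((n - 1) choose j)\<close> for each \<open>j\<close>.\<close>

lemma prod_choose_ratio: "fact n * (\<Prod>j<n. n choose j) = n ^ n * (\<Prod>j<n. (n - 1) choose j)"
proof -
  have "(\<Prod>j<n. n - j) = fact n"
    unfolding fact_prod_rev by (simp add: atLeast0LessThan)
  then have "fact n * (\<Prod>j<n. n choose j) = (\<Prod>j<n. (n - j) * (n choose j))"
    by (simp add: prod.distrib)
  also have "\<dots> = (\<Prod>j<n. n * ((n - 1) choose j))"
    by (simp only: binomial_absorb_comp)
  also have "\<dots> = n ^ n * (\<Prod>j<n. (n - 1) choose j)"
    by (simp add: prod.distrib)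
  finally show ?thesis .
qed

lemma border_rank_det_lower:
  assumes "n \<ge> 1"
  shows "n ^ (n - 1) \<le> border_rank (replicate n n) (det_tensor n :: 'a::field_char_0 tensor) * fact (n - 1)"
proof -
  let ?k = "border_rank (replicate n n) (det_tensor n :: 'a tensor)"
  let ?r = "\<Prod>j<n. (n - 1) choose j"
  have pos: "0 < ?r" by (rule prod_pos) auto
  obtain m where m: "n = Suc m" using assms by (cases n) auto
  have "n ^ n * ?r = fact n * (\<Prod>j<n. n choose j)" by (rule prod_choose_ratio[symmetric])
  also have "\<dots> \<le> fact n * (?k * ?r)"
    by (intro mult_le_mono2 border_rank_det_flattening assms)
  finally have "n ^ n * ?r \<le> (?k * fact n) * ?r" by (simp only: mult_ac)
  then have "n ^ n \<le> ?k * fact n" using pos by simp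
  moreover have "n ^ n = n * n ^ (n - 1)" by (simp add: m)
  moreover have "fact n = n * (fact (n - 1) :: nat)" by (simp add: m)
  then have "?k * fact n = n * (?k * fact (n - 1))" by (simp only: mult.left_commute)
  ultimately have "n * n ^ (n - 1) \<le> n * (?k * fact (n - 1))" by linarith
  then show ?thesis by (rule mult_left_le_imp_le) (use assms in linarith)
qed

section \<open>Glynn's formula for the permanent tensor\<close>

text \<open>A sign vector encoded by the set of its negative positions. Glynn's formula uses
  \<open>S\<close> inside \<open>{1..<n}\<close>, which fixes the sign at 0 to be 1.\<close>

definition sgn_vec :: "nat set \<Rightarrow> nat \<Rightarrow> 'a::comm_ring_1" where
  "sgn_vec S i = (if i \<in> S then - 1 else 1)"

lemma prod_sgn_vec:
  assumes "finite S"
  shows "(\<Prod>j<length I. sgn_vec S (I ! j)) = (\<Prod>k\<in>S. (- 1 :: 'a::comm_ring_1) ^ count_list I k)"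
proof -
  have "prod_list (map (sgn_vec S) I) = (\<Prod>k\<in>S. (- 1 :: 'a) ^ count_list I k)"
  proof (induction I)
    case (Cons i I)
    have "(\<Prod>k\<in>S. (- 1 :: 'a) ^ count_list (i # I) k)
      = (\<Prod>k\<in>S. (if i = k then - 1 else 1) * (- 1) ^ count_list I k)"
      by (intro prod.cong) auto
    also have "\<dots> = sgn_vec S i * (\<Prod>k\<in>S. (- 1) ^ count_list I k)"
      using assms by (simp add: prod.distrib sgn_vec_def)
    finally show ?case using Cons by (simp del: count_list.simps)
  qed simp
  then show ?thesis by (simp add: prod.list_conv_set_nth atLeast0LessThan)
qed

text \<open>A parity argument: if the letter 0 were missing, \<open>n - 1\<close> odd counts would
  add up to \<open>n\<close>. Hence all \<open>n\<close> letters occur in a word of length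
  \<open>n\<close>.\<close>

lemma odd_counts_distinct:
  assumes I: "I \<in> words n n" and "n \<ge> 1" and odd: "\<And>k. k \<in> {1..<n} \<Longrightarrow> odd (count_list I k)"
  shows "distinct I"
proof -
  have l: "length I = n" "set I \<subseteq> {..<n}" using I by (auto simp: words_def)
  have split: "{..<n} = insert 0 {1..<n}" using assms(2) by auto
  have sum: "(\<Sum>k\<in>{..<n}. count_list I k) = n"
    using l by (simp add: sum_count_set)
  have ge: "k \<in> set I" if "k \<in> {1..<n}" for k
    using odd[OF that] by (metis count_notin even_zero)
  have "0 \<in> set I"
  proof (rule ccontr)
    assume "0 \<notin> set I"
    then have "(\<Sum>k\<in>{1..<n}. count_list I k) = n" using sum unfolding split by simp
    moreover have "{k \<in> {1..<n}. odd (count_list I k)} = {1..<n}" using odd by auto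
    then have "even (\<Sum>k\<in>{1..<n}. count_list I k) \<longleftrightarrow> even (n - 1)"
      using even_sum_iff[of "{1..<n}" "count_list I"] by simp
    ultimately show False using assms(2) by simp
  qed
  with ge have "{..<n} \<subseteq> set I" unfolding split by auto
  then have "set I = {..<n}" using l by auto
  then show ?thesis using l by (intro card_distinct) simp
qed

lemma count_list_distinct: "distinct xs \<Longrightarrow> count_list xs x = (if x \<in> set xs then 1 else 0)"
  by (induction xs) auto

text \<open>The sum over subsets factors as a product over letters \<open>k\<close> from 1 to
  \<open>n - 1\<close>. The factor is 2 for an odd count and 0 for an even one, so only words with
  distinct letters survive.\<close>

lemma glynn_sum:
  assumes I: "I \<in> words n n" and n: "n \<ge> 1"
  shows "(\<Sum>S\<in>Pow {1..<n}. (- 1) ^ card S * (\<Prod>j<n. sgn_vec S (I ! j)))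
    = (if distinct I then 2 ^ (n - 1) else (0 :: 'a::comm_ring_1))"
proof -
  have l: "length I = n" "set I \<subseteq> {..<n}" using I by (auto simp: words_def)
  have "(\<Sum>S\<in>Pow {1..<n}. (- 1) ^ card S * (\<Prod>j<n. sgn_vec S (I ! j)))
    = (\<Sum>S\<in>Pow {1..<n}. \<Prod>k\<in>S. (- 1) ^ Suc (count_list I k) :: 'a)"
  proof (rule sum.cong[OF refl])
    fix S assume "S \<in> Pow {1..<n}"
    then have "finite S" using finite_subset by auto
    then show "(- 1) ^ card S * (\<Prod>j<n. sgn_vec S (I ! j)) = (\<Prod>k\<in>S. (- 1) ^ Suc (count_list I k) :: 'a)"
      using prod_sgn_vec[of S I, where 'a = 'a] l 
      by (simp only: power_Suc prod.distrib prod_constant)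
  qed
  also have "\<dots> = (\<Prod>k\<in>{1..<n}. (- 1) ^ Suc (count_list I k) + 1)"
    by (subst prod_add) simp_all
  also have "\<dots> = (if distinct I then 2 ^ (n - 1) else 0)"
  proof (cases "distinct I")
    case True
    have "set I = {..<n}"
      using l distinct_card[OF True] card_subset_eq[of "{..<n}" "set I"] by simp
    then have "count_list I k = 1" if "k \<in> {1..<n}" for k
      using True that by (simp add: count_list_distinct)
    then show ?thesis using True by simp
  next
    case False
    then obtain k where k: "k \<in> {1..<n}" "even (count_list I k)"
      using odd_counts_distinct[OF I n] by blast
    then have "(- 1 :: 'a) ^ Suc (count_list I k) + 1 = 0" by simp
    then have "(\<Prod>k\<in>{1..<n}. (- 1 :: 'a) ^ Suc (count_list I k) + 1) = 0"
      using k(1) by (intro prod_zero) auto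
    then show ?thesis using False by simp
  qed
  finally show ?thesis .
qed

lemma perm_tensor_word:
  assumes "I \<in> words n n"
  shows "perm_tensor n I = (if distinct I then 1 else 0)"
  using distinct_word_permutation[OF assms] perm_tensor_permutation not_distinct_tensor(2)
  by metis

lemma perm_tensor_glynn:
  assumes n: "n \<ge> 1"
  shows "is_sum_of_pure_tensors (replicate n n) (2 ^ (n - 1)) (perm_tensor n :: 'a::field_char_0 tensor)"
proof -
  \<comment> \<open>The scalar in front of each summand is absorbed into slot 0, which exists since
    \<open>n \<ge> 1\<close>.\<close>
  define w :: "nat set \<Rightarrow> 'a vec list" where
    "w S = map (\<lambda>j. vec n (\<lambda>i. (if j = 0 then (- 1) ^ card S / 2 ^ (n - 1) else 1) * sgn_vec S i)) [0..<n]" for S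
  have dims: "map dim_vec (w S) = replicate n n" for S
    by (simp add: w_def comp_def map_replicate_const)
  obtain h where h: "bij_betw h {..<(2::nat) ^ (n - 1)} (Pow {1..<n})"
    using ex_bij_betw_nat_finite[of "Pow {1..<n}"] by (auto simp: atLeast0LessThan card_Pow)
  have "perm_tensor n I = (\<Sum>S\<in>Pow {1..<n}. pure_tensor (w S) I)" for I
  proof (cases "I \<in> words n n")
    case True
    then have l: "length I = n" "\<And>j. j < n \<Longrightarrow> I ! j < n"
      by (auto simp: words_def subset_iff in_set_conv_nth)
    have "pure_tensor (w S) I = (- 1) ^ card S * (\<Prod>j<n. sgn_vec S (I ! j)) / 2 ^ (n - 1)" for S
    proof -
      have "pure_tensor (w S) I
        = (\<Prod>j<n. (if j = 0 then (- 1) ^ card S / 2 ^ (n - 1) else 1) * sgn_vec S (I ! j))"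
        using True l unfolding pure_tensor_def dims multi_indices_replicate
        by (simp add: w_def)
      also have "\<dots> = (\<Prod>j<n. (if j = 0 then (- 1) ^ card S / 2 ^ (n - 1) else 1)) * (\<Prod>j<n. sgn_vec S (I ! j))"
        by (rule prod.distrib)
      also have "(\<Prod>j<n. (if j = 0 then (- 1) ^ card S / 2 ^ (n - 1) else 1)) = (- 1) ^ card S / (2 ^ (n - 1) :: 'a)"
        using n by simp
      finally show ?thesis by simp
    qed
    then have "(\<Sum>S\<in>Pow {1..<n}. pure_tensor (w S) I)
      = (\<Sum>S\<in>Pow {1..<n}. (- 1) ^ card S * (\<Prod>j<n. sgn_vec S (I ! j))) / 2 ^ (n - 1)"
      by (simp only: sum_divide_distrib)
    also have "\<dots> = perm_tensor n I"
      unfolding glynn_sum[OF True n] perm_tensor_word[OF True] by simp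
    finally show ?thesis ..
  next
    case False
    then show ?thesis
      using perm_tensor_in_tensor_space[of n, where 'a = 'a]
      by (simp add: tensor_space_def pure_tensor_def dims multi_indices_replicate)
  qed
  moreover have "(\<Sum>S\<in>Pow {1..<n}. pure_tensor (w S) I) = (\<Sum>i<2 ^ (n - 1). pure_tensor (w (h i)) I)" for I
    by (rule sum.reindex_bij_betw[OF h, symmetric])
  ultimately show ?thesis
    unfolding is_sum_of_pure_tensors_def using dims by (intro exI[of _ "\<lambda>i. w (h i)"]) auto
qed

section \<open>The elementary inequality between the two bounds\<close>

lemma two_power_fact_less:
  assumes "n \<ge> 3"
  shows "(2::nat) ^ (n - 1) * fact (n - 1) < n ^ (n - 1)"
  using assms
proof (induction n rule: dec_induct)
  case base
  then show ?case by (simp add: fact_numeral numeral_3_eq_3)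
next
  case (step n)
  then obtain m where m: "n = Suc m" by (cases n) auto
  \<comment> \<open>From \<open>n\<close> to \<open>n + 1\<close> the left side grows by the factor
    2 n, so it suffices that 2 n^n is at most (n + 1)^n. Bernoulli gives this; the base case is 8 <
    9.\<close>
  have "real (2 * n ^ n) \<le> real (Suc n ^ n)"
  proof -
    have "2 \<le> (1 + 1 / real n) ^ n"
      using Bernoulli_inequality[of "1 / real n" n] step.hyps order_trans[of "- 1" 0 "1 / real n"]
      by simp
    then have "2 * real n ^ n \<le> (1 + 1 / real n) ^ n * real n ^ n"
      by (intro mult_right_mono) auto
    also have "\<dots> = ((1 + 1 / real n) * real n) ^ n" by (simp only: power_mult_distrib)
    also have "(1 + 1 / real n) * real n = real (Suc n)" using step.hyps by (simp add: field_simps)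
    finally show ?thesis by simp
  qed
  then have "2 * n ^ n \<le> Suc n ^ n" by linarith
  moreover have "2 ^ n * fact n = 2 * n * (2 ^ (n - 1) * fact (n - 1))" unfolding m by (simp add: algebra_simps)
  moreover have "2 * n * (2 ^ (n - 1) * fact (n - 1)) < 2 * n * n ^ (n - 1)"
    using step by (intro mult_strict_left_mono) auto
  moreover have "2 * n * n ^ (n - 1) = 2 * n ^ n" unfolding m by simp
  ultimately show ?case unfolding diff_Suc_1 by linarith
qed

theorem mainTheorem5:
  fixes n :: nat
  assumes "n \<ge> 3"
  shows "real (tensor_rank (replicate n n) (perm_tensor n :: 'a::field_char_0 tensor))
           \<le> 2 ^ (n - 1)
       \<and> (2::real) ^ (n - 1) < real n ^ (n - 1) / fact (n - 1)
       \<and> real n ^ (n - 1) / fact (n - 1)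
           \<le> real (border_rank (replicate n n) (det_tensor n :: 'a tensor))
       \<and> border_rank (replicate n n) (det_tensor n :: 'a tensor)
           \<le> tensor_rank (replicate n n) (det_tensor n :: 'a tensor)"
proof (intro conjI)
  have n: "n \<ge> 1" using assms by simp
  have "tensor_rank (replicate n n) (perm_tensor n :: 'a tensor) \<le> 2 ^ (n - 1)"
    unfolding tensor_rank_def by (rule Least_le) (rule perm_tensor_glynn[OF n])
  then have "real (tensor_rank (replicate n n) (perm_tensor n :: 'a tensor)) \<le> real (2 ^ (n - 1))"
    by (rule of_nat_mono)
  then show "real (tensor_rank (replicate n n) (perm_tensor n :: 'a tensor)) \<le> 2 ^ (n - 1)" by simp
  have "real (2 ^ (n - 1) * fact (n - 1)) < real (n ^ (n - 1))"
    using two_power_fact_less[OF assms] by (rule of_nat_less_iff[THEN iffD2])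
  then show "(2::real) ^ (n - 1) < real n ^ (n - 1) / fact (n - 1)"
    by (simp add: less_divide_eq)
  have "real (n ^ (n - 1)) \<le>
    real (border_rank (replicate n n) (det_tensor n :: 'a tensor) * fact (n - 1))"
    by (intro of_nat_mono border_rank_det_lower n)
  then show "real n ^ (n - 1) / fact (n - 1)
    \<le> real (border_rank (replicate n n) (det_tensor n :: 'a tensor))"
    by (simp add: divide_le_eq)
  show "border_rank (replicate n n) (det_tensor n :: 'a tensor)
    \<le> tensor_rank (replicate n n) (det_tensor n :: 'a tensor)"
    by (rule border_rank_le_tensor_rank[OF det_tensor_in_tensor_space])
qed

end
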